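(* Let $\mathbb{K}$ be an algebraically closed field, let $q\in\mathbb{K}^*$ be a primitive $m$-th root of unity, let $\underline{\lambda}=(\lambda_1,\lambda_2)\in(\mathbb{K}^* )^2$, and for $p\ge 1$ let $Q_{p,m}=M(\underline{\lambda})/M_{p,m}$. Then: (1) $Q_{1,m}$ is a simple $\mathcal{M}at_2(q)$-module. (2) When $p>1$, $Q_{p,m}$ is neither a simple nor a semisimple $\mathcal{M}at_2(q)$-module. (3) When $p>1$, $Q_{p,m}$ is an indecomposable $\mathcal{M}at_2(q)$-module.
   Context: All modules are right modules. $\mathcal{M}at_2(q)$ is the associative unital $\mathbb{K}$-algebra generated by $Z_{11},Z_{12},Z_{21},Z_{22}$ with relations $Z_{12}Z_{11}=Z_{11}Z_{12}$, $Z_{21}Z_{11}=qZ_{11}Z_{21}$, $Z_{22}Z_{21}=Z_{21}Z_{22}$, $Z_{22}Z_{12}=qZ_{12}Z_{22}$, $Z_{21}Z_{12}=qZ_{12}Z_{21}$, $Z_{22}Z_{11}=Z_{11}Z_{22}+(q-1)Z_{12}Z_{21}$. Let $\mathcal{B}$ be the subalgebra generated by $Z_{11},Z_{12},Z_{21}^m$; it is a commutative polynomial algebra $\mathbb{K}[Z_{11},Z_{12},Z_{21}^m]$. For $\underline{\lambda}=(\lambda_1,\lambda_2)\in(\mathbb{K}^* )^2$ let $\mathbb{K}(\underline{\lambda})=\mathbb{K}$ be the one-dimensional right $\mathcal{B}$-module with $vZ_{11}=0$, $vZ_{12}=\lambda_1v$, $vZ_{21}^m=\lambda_2v$, and let $M(\underline{\lambda}):=\mathbb{K}(\underline{\lambda})\otimes_{\mathcal{B}}\mathcal{M}at_2(q)$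 (Verma module). With $v\neq 0$ fixed, $M(\underline{\lambda})$ has $\mathbb{K}$-basis $f(a,b):=v\otimes Z_{21}^aZ_{22}^b$, $0\le a\le m-1$, $b\ge 0$. For $p\ge 1$ put $M_{p,m}:=\mathrm{span}\{f(a,pm+i)\mid i\ge 0,\ 0\le a\le m-1\}$, which is an $\mathcal{M}at_2(q)$-submodule of $M(\underline{\lambda})$; so $Q_{p,m}$ is a module of dimension $pm^2$. A module is indecomposable if it is nonzero and is not a direct sum of two nonzero submodules. *)

theory Defs
  imports
    "HOL-Algebra.QuotRing"
    "HOL-Algebra.Generated_Groups"
    "HOL-Algebra.Generated_Rings"
    "HOL-Algebra.Free_Abelian_Groups"
    "HOL-Algebra.Algebraic_Closure_Type"
    "HOL-Computational_Algebra.Polynomial"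
    "HOL-Library.Poly_Mapping"
    "HOL-Library.FuncSet"
begin

section \<open>Right modules over a not necessarily commutative ring\<close>

text \<open>
  HOL-Algebra's modules are left modules over commutative rings.  As there, the abelian group
  is stored in a ring record whose fields \<open>mult\<close> and \<open>one\<close> play no role.
\<close>

record ('a, 'm) rmodule = "'m ring" +
  ract :: "['m, 'a] \<Rightarrow> 'm" (infixl \<open>\<triangleleft>\<index>\<close> 70)

locale right_module = R?: ring R + M?: abelian_group M
  for R :: "('a, 'b) ring_scheme" (structure) and M :: "('a, 'm, 'c) rmodule_scheme" (structure) +
  assumes ract_closed:
      "\<lbrakk>x \<in> carrier M; a \<in> carrier R\<rbrakk> \<Longrightarrow> x \<triangleleft>\<^bsub>M\<^esub> a \<in> carrier M"
    and ract_add_left: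
      "\<lbrakk>x \<in> carrier M; y \<in> carrier M; a \<in> carrier R\<rbrakk> \<Longrightarrow>
        (x \<oplus>\<^bsub>M\<^esub> y) \<triangleleft>\<^bsub>M\<^esub> a = x \<triangleleft>\<^bsub>M\<^esub> a \<oplus>\<^bsub>M\<^esub> y \<triangleleft>\<^bsub>M\<^esub> a"
    and ract_add_right:
      "\<lbrakk>x \<in> carrier M; a \<in> carrier R; b \<in> carrier R\<rbrakk> \<Longrightarrow>
        x \<triangleleft>\<^bsub>M\<^esub> (a \<oplus>\<^bsub>R\<^esub> b) = x \<triangleleft>\<^bsub>M\<^esub> a \<oplus>\<^bsub>M\<^esub> x \<triangleleft>\<^bsub>M\<^esub> b"
    and ract_mult:
      "\<lbrakk>x \<in> carrier M; a \<in> carrier R; b \<in> carrier R\<rbrakk> \<Longrightarrow>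
        x \<triangleleft>\<^bsub>M\<^esub> (a \<otimes>\<^bsub>R\<^esub> b) = x \<triangleleft>\<^bsub>M\<^esub> a \<triangleleft>\<^bsub>M\<^esub> b"
    and ract_one:
      "x \<in> carrier M \<Longrightarrow> x \<triangleleft>\<^bsub>M\<^esub> \<one>\<^bsub>R\<^esub> = x"

locale right_submodule = additive_subgroup N M
  for N and R :: "('a, 'b) ring_scheme" and M :: "('a, 'm, 'c) rmodule_scheme" (structure) +
  assumes ract_closed: "\<lbrakk>x \<in> N; a \<in> carrier R\<rbrakk> \<Longrightarrow> x \<triangleleft>\<^bsub>M\<^esub> a \<in> N"

definition rspan ::
    "('a, 'b) ring_scheme \<Rightarrow> ('a, 'm, 'c) rmodule_scheme \<Rightarrow> 'm set \<Rightarrow> 'm set"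
  where "rspan R M S = \<Inter>{N. right_submodule N R M \<and> S \<subseteq> N}"

definition rquot :: "('a, 'm, 'c) rmodule_scheme \<Rightarrow> 'm set \<Rightarrow> ('a, 'm set) rmodule"
  where "rquot M N =
    \<lparr>carrier = a_rcosets\<^bsub>M\<^esub> N, monoid.mult = undefined, one = undefined,
     ring.zero = N, add = set_add M,
     ract = (\<lambda>C a. \<Union>x\<in>C. N +>\<^bsub>M\<^esub> (x \<triangleleft>\<^bsub>M\<^esub> a))\<rparr>"

definition simple_rmodule :: "('a, 'b) ring_scheme \<Rightarrow> ('a, 'm, 'c) rmodule_scheme \<Rightarrow> bool"
  where "simple_rmodule R M \<longleftrightarrow>
    right_module R M \<and> carrier M \<noteq> {\<zero>\<^bsub>M\<^esub>} \<and>
    (\<forall>N. right_submodule N R M \<longrightarrow> N = {\<zero>\<^bsub>M\<^esub>} \<or> N = carrier M)"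

text \<open>
  Semisimple: internal direct sum of a (possibly empty or infinite) family of simple submodules.
  The span of a union of submodules is their sum.
\<close>

definition semisimple_rmodule :: "('a, 'b) ring_scheme \<Rightarrow> ('a, 'm, 'c) rmodule_scheme \<Rightarrow> bool"
  where "semisimple_rmodule R M \<longleftrightarrow>
    right_module R M \<and>
    (\<exists>\<S>. (\<forall>S\<in>\<S>. right_submodule S R M \<and> simple_rmodule R (M\<lparr>carrier := S\<rparr>)) \<and>
         rspan R M (\<Union>\<S>) = carrier M \<and>
         (\<forall>S\<in>\<S>. S \<inter> rspan R M (\<Union>(\<S> - {S})) = {\<zero>\<^bsub>M\<^esub>}))"

definition indecomposable_rmodule ::
    "('a, 'b) ring_scheme \<Rightarrow> ('a, 'm, 'c) rmodule_scheme \<Rightarrow> bool"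
  where "indecomposable_rmodule R M \<longleftrightarrow>
    right_module R M \<and> carrier M \<noteq> {\<zero>\<^bsub>M\<^esub>} \<and>
    \<not> (\<exists>N L. right_submodule N R M \<and> right_submodule L R M \<and>
            N \<noteq> {\<zero>\<^bsub>M\<^esub>} \<and> L \<noteq> {\<zero>\<^bsub>M\<^esub>} \<and>
            N \<inter> L = {\<zero>\<^bsub>M\<^esub>} \<and> N <+>\<^bsub>M\<^esub> L = carrier M)"


section \<open>Extension of scalars\<close>

text \<open>
  For a subring \<open>B\<close> of \<open>A\<close> and a right \<open>B\<close>-module \<open>N\<close>, the right \<open>A\<close>-module \<open>N \<otimes>\<^sub>B A\<close> is the
  free abelian group on \<open>N \<times> A\<close>, on which \<open>c\<close> acts by \<open>(x, a) \<mapsto> (x, a c)\<close>, modulo the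
  biadditivity and \<open>B\<close>-balancing relations.
\<close>

definition tensor_free ::
    "('a, 'n, 'c) rmodule_scheme \<Rightarrow> ('a, 'b) ring_scheme \<Rightarrow> ('a, ('n \<times> 'a) \<Rightarrow>\<^sub>0 int) rmodule"
  where "tensor_free N A =
    \<lparr>carrier = carrier (free_Abelian_group (carrier N \<times> carrier A)),
     monoid.mult = undefined, one = undefined, ring.zero = 0, add = (+),
     ract = (\<lambda>u c. frag_extend (\<lambda>(x, a). frag_of (x, a \<otimes>\<^bsub>A\<^esub> c)) u)\<rparr>"

definition tensor_rels ::
    "'a set \<Rightarrow> ('a, 'n, 'c) rmodule_scheme \<Rightarrow> ('a, 'b) ring_scheme \<Rightarrow> (('n \<times> 'a) \<Rightarrow>\<^sub>0 int) set"
  where "tensor_rels B N A =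
    {frag_of (x \<oplus>\<^bsub>N\<^esub> y, a) - frag_of (x, a) - frag_of (y, a) | x y a.
       x \<in> carrier N \<and> y \<in> carrier N \<and> a \<in> carrier A} \<union>
    {frag_of (x, a \<oplus>\<^bsub>A\<^esub> b) - frag_of (x, a) - frag_of (x, b) | x a b.
       x \<in> carrier N \<and> a \<in> carrier A \<and> b \<in> carrier A} \<union>
    {frag_of (x \<triangleleft>\<^bsub>N\<^esub> r, a) - frag_of (x, r \<otimes>\<^bsub>A\<^esub> a) | x r a.
       x \<in> carrier N \<and> r \<in> B \<and> a \<in> carrier A}"

definition tensor_null ::
    "'a set \<Rightarrow> ('a, 'n, 'c) rmodule_scheme \<Rightarrow> ('a, 'b) ring_scheme \<Rightarrow> (('n \<times> 'a) \<Rightarrow>\<^sub>0 int) set"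
  where "tensor_null B N A = generate (add_monoid (tensor_free N A)) (tensor_rels B N A)"

definition extend_scalars ::
    "'a set \<Rightarrow> ('a, 'n, 'c) rmodule_scheme \<Rightarrow> ('a, 'b) ring_scheme \<Rightarrow>
      ('a, (('n \<times> 'a) \<Rightarrow>\<^sub>0 int) set) rmodule"
  where "extend_scalars B N A = rquot (tensor_free N A) (tensor_null B N A)"

definition pure_tensor ::
    "'a set \<Rightarrow> ('a, 'n, 'c) rmodule_scheme \<Rightarrow> ('a, 'b) ring_scheme \<Rightarrow> 'n \<Rightarrow> 'a \<Rightarrow>
      (('n \<times> 'a) \<Rightarrow>\<^sub>0 int) set"
  where "pure_tensor B N A x a = tensor_null B N A +>\<^bsub>tensor_free N A\<^esub> frag_of (x, a)"


section \<open>The quantum matrix algebra\<close>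

datatype 'x free_monoid = Word "'x list"

instantiation free_monoid :: (type) monoid_add
begin

definition zero_free_monoid :: "'a free_monoid"
  where "0 = Word []"

fun plus_free_monoid :: "'a free_monoid \<Rightarrow> 'a free_monoid \<Rightarrow> 'a free_monoid"
  where "Word xs + Word ys = Word (xs @ ys)"

instance
proof
  fix a b c :: "'a free_monoid"
  show "a + b + c = a + (b + c)"
    by (cases a; cases b; cases c) simp
  show "0 + a = a" "a + 0 = a"
    by (cases a; simp add: zero_free_monoid_def)+
qed

end

text \<open>
  The ring structure on \<open>\<Rightarrow>\<^sub>0\<close> is convolution along the additively written monoid of keys, so
  this type is the free associative unital algebra over \<open>'k\<close> on the letters \<open>'x\<close>.
\<close>

type_synonym ('x, 'k) free_algebra = "'x free_monoid \<Rightarrow>\<^sub>0 'k"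

datatype gen = G11 | G12 | G21 | G22

definition letter :: "'x \<Rightarrow> ('x, 'k::field) free_algebra"
  where "letter x = Poly_Mapping.single (Word [x]) 1"

definition const :: "'k::field \<Rightarrow> ('x, 'k) free_algebra"
  where "const c = Poly_Mapping.single 0 c"

definition mat2_rels :: "'k::field \<Rightarrow> (gen, 'k) free_algebra set"
  where "mat2_rels q =
   {letter G12 * letter G11 - letter G11 * letter G12,
    letter G21 * letter G11 - const q * letter G11 * letter G21,
    letter G22 * letter G21 - letter G21 * letter G22,
    letter G22 * letter G12 - const q * letter G12 * letter G22,
    letter G21 * letter G12 - const q * letter G12 * letter G21,
    letter G22 * letter G11 - (letter G11 * letter G22 + const (q - 1) * letter G12 * letter G21)}"

definition mat2_ideal :: "'k::field \<Rightarrow> (gen, 'k) free_algebra set"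
  where "mat2_ideal q = Idl\<^bsub>ring_of_type_algebra\<^esub> (mat2_rels q)"

definition Mat2 :: "'k::field \<Rightarrow> (gen, 'k) free_algebra set ring"
  where "Mat2 q = ring_of_type_algebra Quot mat2_ideal q"

definition Z :: "'k::field \<Rightarrow> gen \<Rightarrow> (gen, 'k) free_algebra set"
  where "Z q g = mat2_ideal q +>\<^bsub>ring_of_type_algebra\<^esub> letter g"

text \<open>
  The structure map of the algebra.  A right module over \<open>Mat2 q\<close> is a vector space through it,
  so submodules are automatically subspaces.
\<close>

definition scal :: "'k::field \<Rightarrow> 'k \<Rightarrow> (gen, 'k) free_algebra set"
  where "scal q c = mat2_ideal q +>\<^bsub>ring_of_type_algebra\<^esub> const c"

definition B_alg :: "'k::field \<Rightarrow> nat \<Rightarrow> (gen, 'k) free_algebra set set"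
  where "B_alg q m =
    generate_ring (Mat2 q) (range (scal q) \<union> {Z q G11, Z q G12, Z q G21 [^]\<^bsub>Mat2 q\<^esub> m})"


section \<open>Verma modules and their quotients\<close>

definition line_rmodule :: "('k::field \<Rightarrow> 'a \<Rightarrow> 'k) \<Rightarrow> ('a, 'k) rmodule"
  where "line_rmodule act =
    \<lparr>carrier = UNIV, monoid.mult = (*), one = 1, ring.zero = 0, add = (+), ract = act\<rparr>"

text \<open>The values on generators determine the action on \<open>B_alg q m\<close>; extensionality fixes the rest.\<close>

definition K_lambda ::
    "'k::field \<Rightarrow> nat \<Rightarrow> 'k \<Rightarrow> 'k \<Rightarrow> ((gen, 'k) free_algebra set, 'k) rmodule"
  where "K_lambda q m lam1 lam2 = line_rmodule (THE act.
     right_module ((Mat2 q)\<lparr>carrier := B_alg q m\<rparr>) (line_rmodule act) \<and>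
     (\<forall>v c. act v (scal q c) = c * v) \<and>
     (\<forall>v. act v (Z q G11) = 0) \<and>
     (\<forall>v. act v (Z q G12) = lam1 * v) \<and>
     (\<forall>v. act v (Z q G21 [^]\<^bsub>Mat2 q\<^esub> m) = lam2 * v) \<and>
     (\<forall>v. act v \<in> extensional (B_alg q m)))"

type_synonym 'k verma = "(('k \<times> (gen, 'k) free_algebra set) \<Rightarrow>\<^sub>0 int) set"

definition Verma ::
    "'k::field \<Rightarrow> nat \<Rightarrow> 'k \<Rightarrow> 'k \<Rightarrow> ((gen, 'k) free_algebra set, 'k verma) rmodule"
  where "Verma q m lam1 lam2 = extend_scalars (B_alg q m) (K_lambda q m lam1 lam2) (Mat2 q)"

definition f_vec :: "'k::field \<Rightarrow> nat \<Rightarrow> 'k \<Rightarrow> 'k \<Rightarrow> 'k \<Rightarrow> nat \<Rightarrow> nat \<Rightarrow> 'k verma"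
  where "f_vec q m lam1 lam2 v a b =
    pure_tensor (B_alg q m) (K_lambda q m lam1 lam2) (Mat2 q) v
      (Z q G21 [^]\<^bsub>Mat2 q\<^esub> a \<otimes>\<^bsub>Mat2 q\<^esub> Z q G22 [^]\<^bsub>Mat2 q\<^esub> b)"

text \<open>The linear span, i.e. the span over the subring of scalars of \<open>Mat2 q\<close>.\<close>

definition M_sub :: "'k::field \<Rightarrow> nat \<Rightarrow> 'k \<Rightarrow> 'k \<Rightarrow> 'k \<Rightarrow> nat \<Rightarrow> 'k verma set"
  where "M_sub q m lam1 lam2 v p =
    rspan ((Mat2 q)\<lparr>carrier := range (scal q)\<rparr>) (Verma q m lam1 lam2)
      {f_vec q m lam1 lam2 v a (p * m + i) | a i. a < m}"

definition Q_mod ::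
    "'k::field \<Rightarrow> nat \<Rightarrow> 'k \<Rightarrow> 'k \<Rightarrow> 'k \<Rightarrow> nat \<Rightarrow>
      ((gen, 'k) free_algebra set, 'k verma set) rmodule"
  where "Q_mod q m lam1 lam2 v p = rquot (Verma q m lam1 lam2) (M_sub q m lam1 lam2 v p)"

definition primitive_root_of_unity :: "nat \<Rightarrow> 'k::field \<Rightarrow> bool"
  where "primitive_root_of_unity m q \<longleftrightarrow>
    m > 0 \<and> q ^ m = 1 \<and> (\<forall>k. 0 < k \<and> k < m \<longrightarrow> q ^ k \<noteq> 1)"

end

theory Submission
  imports Defs "HOL-Library.Function_Algebras"
begin

text \<open>
  On \<open>M(\<lambda>)\<close> one has \<open>f(a,b) Z\<^sub>1\<^sub>2 = \<lambda>\<^sub>1 q\<^sup>a\<^sup>+\<^sup>b f(a,b)\<close> and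
  \<open>f(a,b) Z\<^sub>1\<^sub>1 = \<lambda>\<^sub>1 q\<^sup>a (q\<^sup>b - 1) f(a+1,b-1)\<close>, while \<open>Z\<^sub>2\<^sub>1\<close> and \<open>Z\<^sub>2\<^sub>2\<close> shift
  \<open>a\<close> (cyclically, up to \<open>\<lambda>\<^sub>2\<close>) and \<open>b\<close>.  These formulas define a module on functions of \<open>(a,b)\<close>
  with \<open>b < p m\<close>.  Its vector at \<open>(0,0)\<close> yields the character of \<open>B\<close> defining \<open>K(\<lambda>)\<close>, and the
  universal property of the tensor product yields a map from \<open>M(\<lambda>)\<close>.  The \<open>f(a,b)\<close> span \<open>M(\<lambda>)\<close>
  and have linearly independent images for \<open>b < p m\<close>, so the kernel is exactly \<open>M\<^sub>p\<^sub>,\<^sub>m\<close>; no normal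
  form theorem for \<open>Mat2 q\<close> is needed.

  In the quotient every nonzero submodule contains \<open>f(0,(p-1)m)\<close>: push a nonzero vector into the
  top row \<open>b = p m - 1\<close> by \<open>Z\<^sub>2\<^sub>2\<close>, lower it to \<open>b = (p-1) m\<close> by \<open>Z\<^sub>1\<^sub>1\<close>, isolate a basis vector by the
  distinct eigenvalues of \<open>Z\<^sub>1\<^sub>2\<close>, and rotate by \<open>Z\<^sub>2\<^sub>1\<close>.  For \<open>p = 1\<close> this vector is the cyclic
  generator, so the quotient is simple.  In general two nonzero submodules always meet, so the
  quotient is indecomposable, and semisimple only if simple; for \<open>p > 1\<close> the vectors supported on
  \<open>b \<ge> m\<close> form a proper nonzero submodule.
\<close>

section \<open>Quotients of right modules\<close>

text \<open>
  The module axioms are only required modulo \<open>N\<close>, because the free abelian group underlying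
  the tensor product satisfies additivity in the ring argument only modulo \<^term>\<open>tensor_null B N A\<close>.
\<close>

locale ract_quotient = R?: ring R + M?: abelian_group M + N?: right_submodule N R M
  for N and R :: "('a, 'b) ring_scheme" and M :: "('a, 'm, 'c) rmodule_scheme" (structure) +
  assumes ract_in_carrier: "\<lbrakk>x \<in> carrier M; a \<in> carrier R\<rbrakk> \<Longrightarrow> x \<triangleleft> a \<in> carrier M"
    and ract_add:
      "\<lbrakk>x \<in> carrier M; y \<in> carrier M; a \<in> carrier R\<rbrakk> \<Longrightarrow> (x \<oplus> y) \<triangleleft> a = x \<triangleleft> a \<oplus> y \<triangleleft> a"
    and ract_add_mod:
      "\<lbrakk>x \<in> carrier M; a \<in> carrier R; b \<in> carrier R\<rbrakk> \<Longrightarrow>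
        x \<triangleleft> (a \<oplus>\<^bsub>R\<^esub> b) \<ominus> (x \<triangleleft> a \<oplus> x \<triangleleft> b) \<in> N"
    and ract_mult_mod:
      "\<lbrakk>x \<in> carrier M; a \<in> carrier R; b \<in> carrier R\<rbrakk> \<Longrightarrow>
        x \<triangleleft> (a \<otimes>\<^bsub>R\<^esub> b) \<ominus> (x \<triangleleft> a \<triangleleft> b) \<in> N"
    and ract_one_mod: "x \<in> carrier M \<Longrightarrow> x \<triangleleft> \<one>\<^bsub>R\<^esub> \<ominus> x \<in> N"
begin

sublocale abelian_subgroup N M
  by (rule abelian_subgroupI3) unfold_locales

lemma carrier_rquot: "carrier (rquot M N) = (\<lambda>x. N +> x) ` carrier M"
  by (auto simp: rquot_def A_RCOSETS_def')

lemma coset_eq_iff: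
  assumes "x \<in> carrier M" "y \<in> carrier M"
  shows "N +> x = N +> y \<longleftrightarrow> x \<ominus> y \<in> N"
  using assms a_rcos_module[of y x] a_repr_independence' a_repr_independenceD
  by (metis a_minus_def a_rcos_self)

lemma add_rquot:
  assumes "x \<in> carrier M" "y \<in> carrier M"
  shows "(N +> x) \<oplus>\<^bsub>rquot M N\<^esub> (N +> y) = N +> (x \<oplus> y)"
  using assms a_rcos_sum by (simp add: rquot_def)

lemma zero_rquot: "\<zero>\<^bsub>rquot M N\<^esub> = N +> \<zero>"
  using a_rcos_const[OF zero_closed] by (simp add: rquot_def)

text \<open>\<open>rquot\<close> acts by a union over all representatives of a coset. Two of them
  differ by some \<open>n \<in> N\<close>, and \<open>n \<triangleleft> a\<close> stays in
  \<open>N\<close>, so the union runs over a nonempty constant family.\<close>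

lemma ract_rquot:
  assumes x: "x \<in> carrier M" and a: "a \<in> carrier R"
  shows "(N +> x) \<triangleleft>\<^bsub>rquot M N\<^esub> a = N +> (x \<triangleleft> a)"
proof -
  have "N +> (y \<triangleleft> a) = N +> (x \<triangleleft> a)" if "y \<in> N +> x" for y
  proof -
    obtain n where n: "n \<in> N" "y = n \<oplus> x"
      using \<open>y \<in> N +> x\<close> by (auto simp: a_r_coset_def')
    have "y \<triangleleft> a \<in> N +> (x \<triangleleft> a)"
      using n x a ract_closed[of n a] ract_add[of n x a] by (auto simp: a_r_coset_def')
    then show ?thesis
      using a_repr_independence'[of "y \<triangleleft> a" "x \<triangleleft> a"] ract_in_carrier x a by metis
  qed
  moreover have "N +> x \<noteq> {}"
    using a_rcos_self[OF x] by blast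
  ultimately have "(\<Union>y\<in>N +> x. N +> (y \<triangleleft> a)) = N +> (x \<triangleleft> a)"
    by (intro SUP_eq_const)
  then show ?thesis
    by (simp add: rquot_def)
qed

lemma abelian_group_rquot: "abelian_group (rquot M N)"
proof (rule abelian_groupI)
  fix C assume "C \<in> carrier (rquot M N)"
  then obtain x where x: "x \<in> carrier M" "C = N +> x"
    by (auto simp: carrier_rquot)
  then show "\<exists>D\<in>carrier (rquot M N). D \<oplus>\<^bsub>rquot M N\<^esub> C = \<zero>\<^bsub>rquot M N\<^esub>"
    by (intro bexI[of _ "N +> (\<ominus> x)"]) (auto simp: carrier_rquot add_rquot zero_rquot l_neg)
qed (auto simp: carrier_rquot add_rquot zero_rquot a_ac)

lemma right_module_rquot: "right_module R (rquot M N)"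
proof -
  have "N +> (x \<triangleleft> (a \<oplus>\<^bsub>R\<^esub> b)) = N +> (x \<triangleleft> a \<oplus> x \<triangleleft> b)"
    "N +> (x \<triangleleft> (a \<otimes>\<^bsub>R\<^esub> b)) = N +> (x \<triangleleft> a \<triangleleft> b)"
    if "x \<in> carrier M" "a \<in> carrier R" "b \<in> carrier R" for x a b
    using that ract_add_mod ract_mult_mod by (simp_all add: coset_eq_iff ract_in_carrier)
  moreover have "N +> (x \<triangleleft> \<one>\<^bsub>R\<^esub>) = N +> x" if "x \<in> carrier M" for x
    using that ract_one_mod by (simp add: coset_eq_iff ract_in_carrier)
  ultimately show ?thesis
    by (intro right_module.intro right_module_axioms.intro)
      (use R.ring_axioms abelian_group_rquot R.one_closed in
       \<open>auto simp: carrier_rquot add_rquot ract_rquot ract_in_carrier ract_add\<close>)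
qed

end

section \<open>Submodules and spans\<close>

context right_module
begin

lemma ract_quotient:
  assumes "right_submodule N R M" shows "ract_quotient N R M"
proof -
  interpret N: right_submodule N R M by fact
  have "x \<ominus>\<^bsub>M\<^esub> x \<in> N" if "x \<in> carrier M" for x
    using that N.zero_closed by (simp add: a_minus_def M.r_neg)
  then show ?thesis
    by (intro ract_quotient.intro ract_quotient_axioms.intro assms)
      (use R.ring_axioms M.abelian_group_axioms in
       \<open>auto simp: ract_closed ract_add_left ract_add_right ract_mult ract_one\<close>)
qed

lemma ract_zero_left:
  assumes a: "a \<in> carrier R" shows "\<zero>\<^bsub>M\<^esub> \<triangleleft>\<^bsub>M\<^esub> a = \<zero>\<^bsub>M\<^esub>"
proof -
  have "\<zero>\<^bsub>M\<^esub> \<triangleleft>\<^bsub>M\<^esub> a \<oplus>\<^bsub>M\<^esub> \<zero>\<^bsub>M\<^esub> \<triangleleft>\<^bsub>M\<^esub> a = \<zero>\<^bsub>M\<^esub> \<triangleleft>\<^bsub>M\<^esub> a"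
    using ract_add_left[OF M.zero_closed M.zero_closed a] M.l_zero[OF M.zero_closed]
    by (simp only:)
  then show ?thesis
    using M.add.l_cancel_one[OF ract_closed[OF M.zero_closed a] ract_closed[OF M.zero_closed a]]
    by (simp only: monoid_record_simps)
qed

lemma ract_minus_left:
  assumes x: "x \<in> carrier M" and a: "a \<in> carrier R"
  shows "(\<ominus>\<^bsub>M\<^esub> x) \<triangleleft>\<^bsub>M\<^esub> a = \<ominus>\<^bsub>M\<^esub> (x \<triangleleft>\<^bsub>M\<^esub> a)"
proof (rule M.minus_equality[symmetric])
  show "(\<ominus>\<^bsub>M\<^esub> x) \<triangleleft>\<^bsub>M\<^esub> a \<oplus>\<^bsub>M\<^esub> x \<triangleleft>\<^bsub>M\<^esub> a = \<zero>\<^bsub>M\<^esub>"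
    using ract_add_left[OF M.a_inv_closed[OF x] x a] M.l_neg[OF x] ract_zero_left[OF a]
    by (simp only:)
qed (simp_all add: assms ract_closed)

lemma ract_zero_right:
  assumes x: "x \<in> carrier M" shows "x \<triangleleft>\<^bsub>M\<^esub> \<zero>\<^bsub>R\<^esub> = \<zero>\<^bsub>M\<^esub>"
proof -
  have "x \<triangleleft>\<^bsub>M\<^esub> \<zero>\<^bsub>R\<^esub> \<oplus>\<^bsub>M\<^esub> x \<triangleleft>\<^bsub>M\<^esub> \<zero>\<^bsub>R\<^esub> = x \<triangleleft>\<^bsub>M\<^esub> \<zero>\<^bsub>R\<^esub>"
    using ract_add_right[OF x R.zero_closed R.zero_closed] R.l_zero[OF R.zero_closed]
    by (simp only:)
  then show ?thesis
    using M.add.l_cancel_one[OF ract_closed[OF x R.zero_closed] ract_closed[OF x R.zero_closed]]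
    by (simp only: monoid_record_simps)
qed

text \<open>Negation is the action of \<open>\<ominus> \<one>\<close>, so closure under the action
  takes care of additive inverses.\<close>

lemma right_submoduleI:
  assumes "N \<subseteq> carrier M" "\<zero>\<^bsub>M\<^esub> \<in> N"
    and "\<And>x y. x \<in> N \<Longrightarrow> y \<in> N \<Longrightarrow> x \<oplus>\<^bsub>M\<^esub> y \<in> N"
    and "\<And>x a. x \<in> N \<Longrightarrow> a \<in> carrier R \<Longrightarrow> x \<triangleleft>\<^bsub>M\<^esub> a \<in> N"
  shows "right_submodule N R M"
proof -
  have "\<ominus>\<^bsub>M\<^esub> x \<in> N" if "x \<in> N" for x
  proof -
    have x: "x \<in> carrier M" using that assms(1) by blast
    have "x \<triangleleft>\<^bsub>M\<^esub> (\<ominus>\<^bsub>R\<^esub> \<one>\<^bsub>R\<^esub>) \<oplus>\<^bsub>M\<^esub> x = \<zero>\<^bsub>M\<^esub>"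
      using ract_add_right[OF x R.a_inv_closed R.one_closed, OF R.one_closed] x
      by (simp only: ract_one R.l_neg R.one_closed ract_zero_right)
    then have "\<ominus>\<^bsub>M\<^esub> x = x \<triangleleft>\<^bsub>M\<^esub> (\<ominus>\<^bsub>R\<^esub> \<one>\<^bsub>R\<^esub>)"
      using M.minus_equality[OF _ x ract_closed[OF x]] by blast
    then show ?thesis using assms(4)[OF that R.a_inv_closed[OF R.one_closed]] by (simp only:)
  qed
  then have "subgroup N (add_monoid M)"
    using assms(1-3) by (intro subgroup.intro) (auto simp: a_inv_def)
  then show ?thesis
    using assms(4)
    by (intro right_submodule.intro additive_subgroup.intro right_submodule_axioms.intro)
qed

lemma zero_submodule: "right_submodule {\<zero>\<^bsub>M\<^esub>} R M"
  by (rule right_submoduleI) (simp_all add: ract_zero_left)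

lemma carrier_submodule: "right_submodule (carrier M) R M"
  by (rule right_submoduleI) (simp_all add: ract_closed)

end

lemma submodule_Inter:
  assumes "\<And>N. N \<in> \<N> \<Longrightarrow> right_submodule N R M" "\<N> \<noteq> {}" "abelian_group M"
  shows "right_submodule (\<Inter>\<N>) R M"
proof -
  interpret abelian_group M by fact
  have "additive_subgroup (\<Inter>\<N>) M"
    unfolding additive_subgroup_def
    by (rule add.subgroups_Inter)
      (use assms in \<open>auto simp: right_submodule_def additive_subgroup_def\<close>)
  then show ?thesis
    using assms by (auto simp: right_submodule_def right_submodule_axioms_def)
qed

lemma rspan_subset: "right_submodule N R M \<Longrightarrow> S \<subseteq> N \<Longrightarrow> rspan R M S \<subseteq> N"
  by (auto simp: rspan_def)

lemma subset_rspan: "S \<subseteq> rspan R M S"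
  by (auto simp: rspan_def)

lemma (in right_module) rspan_submodule:
  assumes "S \<subseteq> carrier M" shows "right_submodule (rspan R M S) R M"
  unfolding rspan_def using carrier_submodule assms M.abelian_group_axioms
  by (intro submodule_Inter) auto

lemma (in right_module) rspan_of_submodule:
  assumes "right_submodule N R M" shows "rspan R M N = N"
  using rspan_subset[OF assms subset_refl] subset_rspan by (rule subset_antisym)

section \<open>Modules with a nonzero element common to all nonzero submodules\<close>

lemma (in right_module) indecomposable_of_monolithic:
  assumes mono: "\<And>N. right_submodule N R M \<Longrightarrow> N \<noteq> {\<zero>\<^bsub>M\<^esub>} \<Longrightarrow> x0 \<in> N"
    and x0: "x0 \<noteq> \<zero>\<^bsub>M\<^esub>" and nz: "carrier M \<noteq> {\<zero>\<^bsub>M\<^esub>}"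
  shows "indecomposable_rmodule R M"
proof -
  have "N \<inter> L \<noteq> {\<zero>\<^bsub>M\<^esub>}" if "right_submodule N R M" "right_submodule L R M"
    "N \<noteq> {\<zero>\<^bsub>M\<^esub>}" "L \<noteq> {\<zero>\<^bsub>M\<^esub>}" for N L
    using mono[OF that(1,3)] mono[OF that(2,4)] x0 by auto
  then show ?thesis
    unfolding indecomposable_rmodule_def using right_module_axioms nz by blast
qed

text \<open>Every simple summand contains \<open>x0\<close>, so two different summands would meet
  nontrivially and break directness. The family is nonempty because the module is nonzero; hence it
  has exactly one member, which is the whole module.\<close>

lemma (in right_module) simple_of_monolithic_semisimple:
  assumes mono: "\<And>N. right_submodule N R M \<Longrightarrow> N \<noteq> {\<zero>\<^bsub>M\<^esub>} \<Longrightarrow> x0 \<in> N"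
    and "x0 \<noteq> \<zero>\<^bsub>M\<^esub>" and nz: "carrier M \<noteq> {\<zero>\<^bsub>M\<^esub>}"
    and semisimple: "semisimple_rmodule R M"
  shows "simple_rmodule R M"
proof -
  obtain \<F> where \<F>: "\<forall>S\<in>\<F>. right_submodule S R M \<and> simple_rmodule R (M\<lparr>carrier := S\<rparr>)"
    and span: "rspan R M (\<Union>\<F>) = carrier M"
    and dir: "\<forall>S\<in>\<F>. S \<inter> rspan R M (\<Union>(\<F> - {S})) = {\<zero>\<^bsub>M\<^esub>}"
    using semisimple unfolding semisimple_rmodule_def by blast
  have sub: "right_submodule S R M" and simple: "simple_rmodule R (M\<lparr>carrier := S\<rparr>)"
    if "S \<in> \<F>" for S
    using \<F> that by simp_all
  have x0: "x0 \<in> S" if "S \<in> \<F>" for S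
    using mono[OF sub[OF that]] simple[OF that] by (simp add: simple_rmodule_def)
  have "\<F> \<noteq> {}"
    using span rspan_subset[OF zero_submodule, of "{}"] nz M.zero_closed by auto
  then obtain S where S: "S \<in> \<F>" by blast
  have "S' = S" if "S' \<in> \<F>" for S'
  proof (rule ccontr)
    assume "S' \<noteq> S"
    then have "x0 \<in> rspan R M (\<Union>(\<F> - {S}))"
      using x0[OF that] that subset_rspan[of "\<Union>(\<F> - {S})" R M] by blast
    with x0[OF S] bspec[OF dir S] \<open>x0 \<noteq> _\<close> show False by auto
  qed
  then have "\<F> = {S}" using S by blast
  then have "carrier M = S"
    using span rspan_of_submodule[OF sub[OF S]] by simp
  moreover have "M\<lparr>carrier := carrier M\<rparr> = M" by simp
  ultimately show ?thesis using simple[OF S] by metis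
qed

text \<open>An additive map killing \<open>N\<close> has the same value on all representatives of a
  coset. The target is a group in the type class sense because the maps used later take values in
  spaces of functions.\<close>

lemma (in ract_quotient) factor_rquot:
  fixes h :: "'m \<Rightarrow> 'v::ab_group_add"
  assumes add: "\<And>x y. x \<in> carrier M \<Longrightarrow> y \<in> carrier M \<Longrightarrow> h (x \<oplus> y) = h x + h y"
    and null: "\<And>x. x \<in> N \<Longrightarrow> h x = 0"
  obtains k where "\<And>x. x \<in> carrier M \<Longrightarrow> k (N +> x) = h x"
    and "\<And>C D. C \<in> carrier (rquot M N) \<Longrightarrow> D \<in> carrier (rquot M N) \<Longrightarrow>
           k (C \<oplus>\<^bsub>rquot M N\<^esub> D) = k C + k D"
proof
  define k where "k C = h (SOME x. x \<in> carrier M \<and> C = N +> x)" for C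
  show k: "k (N +> x) = h x" if x: "x \<in> carrier M" for x
  proof -
    define y where "y = (SOME y. y \<in> carrier M \<and> N +> x = N +> y)"
    have y: "y \<in> carrier M \<and> N +> x = N +> y"
      unfolding y_def by (rule someI[of _ x]) (use x in auto)
    then have "x \<ominus> y \<in> N" using coset_eq_iff x by blast
    moreover have "x = (x \<ominus> y) \<oplus> y"
      using x y by (simp add: a_minus_def a_assoc l_neg)
    ultimately have "h x = h y"
      using add[of "x \<ominus> y" y] null x y by simp
    then show ?thesis by (simp add: k_def y_def)
  qed
  show "k (C \<oplus>\<^bsub>rquot M N\<^esub> D) = k C + k D"
    if "C \<in> carrier (rquot M N)" "D \<in> carrier (rquot M N)" for C D
    using that by (auto simp: carrier_rquot add_rquot k add)
qed

section \<open>Representations of the quantum matrix algebra\<close>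

lemma ring_of_type_algebra_simps [simp]:
  "carrier (ring_of_type_algebra :: 'a::ring_1 ring) = UNIV"
  "x \<otimes>\<^bsub>ring_of_type_algebra\<^esub> y = x * (y::'a)"
  "x \<oplus>\<^bsub>ring_of_type_algebra\<^esub> y = x + (y::'a)"
  "\<one>\<^bsub>ring_of_type_algebra\<^esub> = (1::'a)"
  "\<zero>\<^bsub>ring_of_type_algebra\<^esub> = (0::'a)"
  by (simp_all add: ring_of_type_algebra_def)

lemma ring_ring_of_type_algebra: "ring (ring_of_type_algebra :: 'a::ring_1 ring)"
  by (intro ringI abelian_groupI monoidI)
    (auto simp: algebra_simps intro: exI[of _ "- _"] add.left_inverse)

text \<open>Products act from the right, so the first letter of a word is applied first; this is the
  order of \<open>fold\<close>.\<close>

definition word_op :: "('x \<Rightarrow> 'v \<Rightarrow> 'v) \<Rightarrow> 'x free_monoid \<Rightarrow> 'v \<Rightarrow> 'v"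
  where "word_op \<rho> w = (case w of Word xs \<Rightarrow> fold \<rho> xs)"

lemma word_op_simps [simp]:
  "word_op \<rho> 0 g = g" "word_op \<rho> (Word xs) = fold \<rho> xs"
  by (simp_all add: word_op_def zero_free_monoid_def)

lemma word_op_add: "word_op \<rho> (u + w) g = word_op \<rho> w (word_op \<rho> u g)"
  by (cases u; cases w) simp

definition scale_fun :: "'k::field \<Rightarrow> ('i \<Rightarrow> 'k) \<Rightarrow> 'i \<Rightarrow> 'k"
  where "scale_fun c g = (\<lambda>i. c * g i)"

lemma scale_fun_apply: "scale_fun c g i = c * g i"
  by (simp add: scale_fun_def)

definition linear_op :: "(('i \<Rightarrow> 'k::field) \<Rightarrow> 'i \<Rightarrow> 'k) \<Rightarrow> bool"
  where "linear_op T \<longleftrightarrow>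
    (\<forall>f g. T (f + g) = T f + T g) \<and> (\<forall>c g. T (scale_fun c g) = scale_fun c (T g))"

lemma scale_fun_simps:
  "scale_fun c (f + g) = scale_fun c f + scale_fun c g"
  "scale_fun (c + d) g = scale_fun c g + scale_fun d g"
  "scale_fun c (scale_fun d g) = scale_fun (c * d) g"
  "scale_fun 1 g = g" "scale_fun 0 g = 0" "scale_fun c 0 = 0"
  by (auto simp: fun_eq_iff scale_fun_def algebra_simps)

lemma linear_op_word_op:
  assumes "\<And>x. linear_op (\<rho> x)" shows "linear_op (word_op \<rho> w)"
proof (cases w)
  case (Word xs)
  have "linear_op (fold \<rho> xs)"
    by (induction xs) (use assms in \<open>auto simp: linear_op_def\<close>)
  with Word show ?thesis by simp
qed

definition eval_op ::
    "('x \<Rightarrow> ('i \<Rightarrow> 'k::field) \<Rightarrow> 'i \<Rightarrow> 'k) \<Rightarrow> ('x, 'k) free_algebra \<Rightarrow> ('i \<Rightarrow> 'k) \<Rightarrow> 'i \<Rightarrow> 'k"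
  where "eval_op \<rho> P g =
    (\<Sum>w\<in>Poly_Mapping.keys P. scale_fun (Poly_Mapping.lookup P w) (word_op \<rho> w g))"

lemma eval_op_superset:
  assumes "finite A" "Poly_Mapping.keys P \<subseteq> A"
  shows "eval_op \<rho> P g = (\<Sum>w\<in>A. scale_fun (Poly_Mapping.lookup P w) (word_op \<rho> w g))"
  unfolding eval_op_def using assms
  by (intro sum.mono_neutral_left) (auto simp: in_keys_iff scale_fun_simps)

lemma eval_op_add: "eval_op \<rho> (P + Q) g = eval_op \<rho> P g + eval_op \<rho> Q g"
proof -
  let ?A = "Poly_Mapping.keys P \<union> Poly_Mapping.keys Q"
  have "Poly_Mapping.keys (P + Q) \<subseteq> ?A" by (rule keys_add)
  then show ?thesis
    by (simp add: eval_op_superset[of ?A] lookup_add scale_fun_simps sum.distrib)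
qed

lemma eval_op_zero: "eval_op \<rho> 0 g = 0"
  by (simp add: eval_op_def)

lemma eval_op_uminus: "eval_op \<rho> (- P) g = - eval_op \<rho> P g"
  using eval_op_add[of \<rho> P "- P" g] by (simp add: eval_op_zero eq_neg_iff_add_eq_0 add.commute)

lemma eval_op_diff: "eval_op \<rho> (P - Q) g = eval_op \<rho> P g - eval_op \<rho> Q g"
  using eval_op_add[of \<rho> P "- Q" g] by (simp add: eval_op_uminus)

lemma eval_op_single: "eval_op \<rho> (Poly_Mapping.single w c) g = scale_fun c (word_op \<rho> w g)"
  by (simp add: eval_op_superset[of "{w}"])

lemma eval_op_letter: "eval_op \<rho> (letter x) g = \<rho> x g"
  by (simp add: letter_def eval_op_single scale_fun_simps)

lemma eval_op_const: "eval_op \<rho> (const c) g = scale_fun c g"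
  by (simp add: const_def eval_op_single)

lemma eval_op_one: "eval_op \<rho> 1 g = g"
  using eval_op_const[of \<rho> 1 g] by (simp add: const_def scale_fun_simps)

lemma free_algebra_induct [case_names single add]:
  fixes P :: "('x, 'k::field) free_algebra"
  assumes "\<And>w c. A (Poly_Mapping.single w c)" and "\<And>P Q. A P \<Longrightarrow> A Q \<Longrightarrow> A (P + Q)"
  shows "A P"
proof (induction P rule: update_induct)
  case const
  show ?case using assms(1)[of 0 0] by simp
next
  case (update f a b)
  have "Poly_Mapping.update a b f = f + Poly_Mapping.single a b"
    using update(1) by (intro poly_mapping_eqI)
      (auto simp: lookup_update lookup_add lookup_single when_def in_keys_iff)
  with update assms show ?case by simp
qed

lemma linear_op_eval_op:
  assumes "\<And>x. linear_op (\<rho> x)" shows "linear_op (eval_op \<rho> P)"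
proof (induction P rule: free_algebra_induct)
  case (single w c)
  show ?case
    using linear_op_word_op[of \<rho> w, OF assms]
    unfolding linear_op_def eval_op_single
    by (simp add: scale_fun_simps(1,3) mult.commute)
next
  case (add P Q)
  then show ?case
    unfolding linear_op_def eval_op_add by (simp add: scale_fun_simps(1,3))
qed

text \<open>Scalars and sums coming from \<open>P\<close> must pass through the words of
  \<open>Q\<close>, which is where linearity of the letters enters. The order of composition is that
  of a right action.\<close>

lemma eval_op_mult:
  assumes "\<And>x. linear_op (\<rho> x)"
  shows "eval_op \<rho> (P * Q) g = eval_op \<rho> Q (eval_op \<rho> P g)"
proof (induction Q rule: free_algebra_induct)
  case Q: (single w d)
  show ?case
  proof (induction P rule: free_algebra_induct)
    case (single u c)
    show ?case
      using linear_op_word_op[of \<rho> w, OF assms]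
      by (simp add: mult_single eval_op_single word_op_add linear_op_def scale_fun_simps mult.commute)
  next
    case (add P P')
    then show ?case
      using linear_op_eval_op[of \<rho> "Poly_Mapping.single w d", OF assms]
      by (simp only: distrib_right eval_op_add linear_op_def)
  qed
next
  case (add P Q)
  then show ?case by (simp add: distrib_left eval_op_add)
qed

section \<open>Cosets and induction in \<open>Mat2 q\<close>\<close>

definition cls :: "'k::field \<Rightarrow> (gen, 'k) free_algebra \<Rightarrow> (gen, 'k) free_algebra set"
  where "cls q P = mat2_ideal q +>\<^bsub>ring_of_type_algebra\<^esub> P"

lemma ideal_mat2_ideal: "ideal (mat2_ideal q) ring_of_type_algebra"
  unfolding mat2_ideal_def by (rule ring.genideal_ideal[OF ring_ring_of_type_algebra]) simp

lemma ring_Mat2: "ring (Mat2 q)"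
  unfolding Mat2_def by (rule ideal.quotient_is_ring[OF ideal_mat2_ideal])

lemma cls_eq_iff: "cls q P = cls q Q \<longleftrightarrow> P - Q \<in> mat2_ideal q"
proof -
  interpret ring "ring_of_type_algebra :: (gen, 'a) free_algebra ring"
    by (rule ring_ring_of_type_algebra)
  have "\<ominus>\<^bsub>ring_of_type_algebra\<^esub> Q = - Q"
    by (rule minus_equality) auto
  then show ?thesis
    unfolding cls_def
    by (subst quotient_eq_iff_same_a_r_cos[OF ideal_mat2_ideal, symmetric]) (auto simp: a_minus_def)
qed

lemma cls_hom: "cls q \<in> ring_hom ring_of_type_algebra (Mat2 q)"
  unfolding cls_def[abs_def] Mat2_def by (rule ideal.rcos_ring_hom[OF ideal_mat2_ideal])

lemma cls_add: "cls q P \<oplus>\<^bsub>Mat2 q\<^esub> cls q Q = cls q (P + Q)"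
  using ring_hom_add[OF cls_hom, of P Q] by simp

lemma cls_mult: "cls q P \<otimes>\<^bsub>Mat2 q\<^esub> cls q Q = cls q (P * Q)"
  using ring_hom_mult[OF cls_hom, of P Q] by simp

lemma one_Mat2: "\<one>\<^bsub>Mat2 q\<^esub> = cls q 1"
  using ring_hom_one[OF cls_hom, of q] by simp

lemma carrier_Mat2: "carrier (Mat2 q) = range (cls q)"
  by (auto simp: Mat2_def FactRing_def A_RCOSETS_def' cls_def)

lemma cls_in_carrier [simp]: "cls q P \<in> carrier (Mat2 q)"
  by (simp add: carrier_Mat2)

lemma zero_Mat2: "\<zero>\<^bsub>Mat2 q\<^esub> = cls q 0"
proof -
  interpret ring "Mat2 q" by (rule ring_Mat2)
  have "cls q 0 \<oplus>\<^bsub>Mat2 q\<^esub> cls q 0 = cls q 0" by (simp add: cls_add)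
  then show ?thesis
    using add.l_cancel_one[of "cls q 0" "cls q 0"] by simp
qed

lemma pow_cls: "cls q P [^]\<^bsub>Mat2 q\<^esub> n = cls q (P ^ n)"
proof -
  interpret ring "Mat2 q" by (rule ring_Mat2)
  show ?thesis
    by (induction n) (simp_all add: one_Mat2 cls_mult flip: power_Suc2)
qed

lemma Z_cls: "Z q g = cls q (letter g)"
  by (simp add: Z_def cls_def)

lemma scal_cls: "scal q c = cls q (const c)"
  by (simp add: scal_def cls_def)

lemma const_simps:
  "const 1 = 1" "const 0 = 0" "const (c + d) = const c + const d" "const (c * d) = const c * const d"
  by (simp_all add: const_def single_add mult_single)

lemma const_commutes: "const c * P = P * const c"
  by (induction P rule: free_algebra_induct)
    (simp_all add: const_def mult_single mult.commute distrib_left distrib_right)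

lemma cls_relI:
  assumes "P - Q \<in> mat2_rels q" shows "cls q P = cls q Q"
proof -
  have "mat2_rels q \<subseteq> mat2_ideal q"
    unfolding mat2_ideal_def by (rule ring.genideal_self[OF ring_ring_of_type_algebra]) simp
  with assms show ?thesis by (auto simp: cls_eq_iff)
qed

lemma Mat2_relations:
  "cls q (letter G12 * letter G11) = cls q (letter G11 * letter G12)"
  "cls q (letter G21 * letter G11) = cls q (const q * letter G11 * letter G21)"
  "cls q (letter G22 * letter G21) = cls q (letter G21 * letter G22)"
  "cls q (letter G22 * letter G12) = cls q (const q * letter G12 * letter G22)"
  "cls q (letter G21 * letter G12) = cls q (const q * letter G12 * letter G21)"
  "cls q (letter G22 * letter G11) =
     cls q (letter G11 * letter G22 + const (q - 1) * letter G12 * letter G21)"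
  by (rule cls_relI; simp add: mat2_rels_def)+

lemma Word_prod_list: "Poly_Mapping.single (Word xs) c = const c * prod_list (map letter xs)"
proof (induction xs rule: rev_induct)
  case Nil
  show ?case by (simp add: const_def zero_free_monoid_def)
next
  case (snoc x xs)
  have "Poly_Mapping.single (Word (xs @ [x])) c = Poly_Mapping.single (Word xs) c * letter x"
    by (simp add: letter_def mult_single)
  with snoc show ?case by (simp add: mult.assoc)
qed

text \<open>Words are built by appending letters on the right. In a right module the product step
  then reads \<open>u \<triangleleft> (a \<otimes> Z) = u \<triangleleft> a \<triangleleft>
  Z\<close>, so only the effect of a single generator has to be known.\<close>

lemma Mat2_induct [consumes 1, case_names scal mult add]:
  assumes "a \<in> carrier (Mat2 q)"
    and scal: "\<And>c. A (scal q c)"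
    and mult: "\<And>a g. a \<in> carrier (Mat2 q) \<Longrightarrow> A a \<Longrightarrow> A (a \<otimes>\<^bsub>Mat2 q\<^esub> Z q g)"
    and add: "\<And>a b. \<lbrakk>a \<in> carrier (Mat2 q); b \<in> carrier (Mat2 q); A a; A b\<rbrakk> \<Longrightarrow> A (a \<oplus>\<^bsub>Mat2 q\<^esub> b)"
  shows "A a"
proof -
  obtain P where P: "a = cls q P"
    using assms(1) by (auto simp: carrier_Mat2)
  have "A (cls q P)"
  proof (induction P rule: free_algebra_induct)
    case (single w c)
    obtain xs where w: "w = Word xs" by (cases w)
    have "A (cls q (const c * prod_list (map letter xs)))"
    proof (induction xs rule: rev_induct)
      case Nil
      show ?case using scal by (simp add: scal_cls)
    next
      case (snoc x xs)
      from mult[OF _ this, of x] show ?case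
        by (simp add: Z_cls cls_mult mult.assoc)
    qed
    then show ?case by (simp add: w Word_prod_list)
  next
    case (add P Q)
    then show ?case using assms(4)[of "cls q P" "cls q Q"] by (simp add: cls_add)
  qed
  with P show ?thesis by simp
qed

text \<open>The six relations for operators of a right action: a product \<open>x * y\<close> acts
  as first \<open>\<rho> x\<close>, then \<open>\<rho> y\<close>, so each composition shows its
  generators in reverse order.\<close>

definition mat2_ops :: "'k::field \<Rightarrow> (gen \<Rightarrow> ('i \<Rightarrow> 'k) \<Rightarrow> 'i \<Rightarrow> 'k) \<Rightarrow> bool"
  where "mat2_ops q \<rho> \<longleftrightarrow> (\<forall>x. linear_op (\<rho> x)) \<and> (\<forall>g.
     \<rho> G11 (\<rho> G12 g) = \<rho> G12 (\<rho> G11 g) \<and>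
     \<rho> G11 (\<rho> G21 g) = scale_fun q (\<rho> G21 (\<rho> G11 g)) \<and>
     \<rho> G21 (\<rho> G22 g) = \<rho> G22 (\<rho> G21 g) \<and>
     \<rho> G12 (\<rho> G22 g) = scale_fun q (\<rho> G22 (\<rho> G12 g)) \<and>
     \<rho> G12 (\<rho> G21 g) = scale_fun q (\<rho> G21 (\<rho> G12 g)) \<and>
     \<rho> G11 (\<rho> G22 g) = \<rho> G22 (\<rho> G11 g) + scale_fun (q - 1) (\<rho> G21 (\<rho> G12 g)))"

text \<open>The elements acting as zero form a two-sided ideal; for a right multiple
  \<open>P * Q\<close> this uses \<open>eval_op \<rho> Q 0 = 0\<close>, which holds by linearity.
  The ideal contains the six relations and hence all of \<open>mat2_ideal q\<close>.\<close>

lemma eval_op_mat2_ideal: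
  assumes \<rho>: "mat2_ops q \<rho>" and P: "P \<in> mat2_ideal q"
  shows "eval_op \<rho> P g = 0"
proof -
  have linop: "linear_op (\<rho> x)" for x
    using \<rho> by (simp add: mat2_ops_def)
  then have linop': "\<rho> x (f + g) = \<rho> x f + \<rho> x g" "\<rho> x (scale_fun c g) = scale_fun c (\<rho> x g)" for x f g c
    by (simp_all add: linear_op_def)
  have ev0: "eval_op \<rho> Q 0 = 0" for Q
    using linear_op_eval_op[of \<rho> Q, OF linop] unfolding linear_op_def
    by (metis scale_fun_simps(5))
  let ?I = "{P. \<forall>g. eval_op \<rho> P g = 0}"
  interpret ring "ring_of_type_algebra :: (gen, 'a) free_algebra ring"
    by (rule ring_ring_of_type_algebra)
  have neg: "\<ominus>\<^bsub>ring_of_type_algebra\<^esub> Q = - Q" for Q :: "(gen, 'a) free_algebra"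
    by (rule minus_equality) auto
  have "ideal ?I ring_of_type_algebra"
  proof (intro idealI ring_ring_of_type_algebra subgroup.intro)
    fix Q assume "Q \<in> ?I"
    then show "inv\<^bsub>add_monoid ring_of_type_algebra\<^esub> Q \<in> ?I"
      using neg[of Q] by (simp add: a_inv_def eval_op_uminus)
  qed (simp_all add: eval_op_add eval_op_zero eval_op_mult[OF linop] ev0)
  moreover have "mat2_rels q \<subseteq> ?I"
    using \<rho> by (auto simp: mat2_rels_def eval_op_add eval_op_diff eval_op_mult linop linop'
        eval_op_letter eval_op_const mat2_ops_def)
  ultimately have "mat2_ideal q \<subseteq> ?I"
    unfolding mat2_ideal_def by (rule genideal_minimal)
  with P show ?thesis by blast
qed

definition mat2_act ::
    "'k::field \<Rightarrow> (gen \<Rightarrow> ('i \<Rightarrow> 'k) \<Rightarrow> 'i \<Rightarrow> 'k) \<Rightarrow> (gen, 'k) free_algebra set \<Rightarrow> ('i \<Rightarrow> 'k) \<Rightarrow> 'i \<Rightarrow> 'k"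
  where "mat2_act q \<rho> C = eval_op \<rho> (SOME P. cls q P = C)"

lemma mat2_act_cls:
  assumes \<rho>: "mat2_ops q \<rho>" shows "mat2_act q \<rho> (cls q P) = eval_op \<rho> P"
proof
  fix g
  define P' where "P' = (SOME P'. cls q P' = cls q P)"
  have "cls q P' = cls q P"
    unfolding P'_def by (rule someI[of _ P]) simp
  then have "eval_op \<rho> (P' - P) g = 0"
    using eval_op_mat2_ideal[OF \<rho>] by (simp add: cls_eq_iff)
  then show "mat2_act q \<rho> (cls q P) g = eval_op \<rho> P g"
    by (simp add: mat2_act_def P'_def eval_op_diff)
qed

lemma mat2_act_simps:
  assumes "mat2_ops q \<rho>"
  shows "mat2_act q \<rho> (Z q x) g = \<rho> x g"
    and "mat2_act q \<rho> (scal q c) g = scale_fun c g"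
    and "mat2_act q \<rho> \<one>\<^bsub>Mat2 q\<^esub> g = g"
    and "\<lbrakk>a \<in> carrier (Mat2 q); b \<in> carrier (Mat2 q)\<rbrakk> \<Longrightarrow>
      mat2_act q \<rho> (a \<oplus>\<^bsub>Mat2 q\<^esub> b) g = mat2_act q \<rho> a g + mat2_act q \<rho> b g"
    and "\<lbrakk>a \<in> carrier (Mat2 q); b \<in> carrier (Mat2 q)\<rbrakk> \<Longrightarrow>
      mat2_act q \<rho> (a \<otimes>\<^bsub>Mat2 q\<^esub> b) g = mat2_act q \<rho> b (mat2_act q \<rho> a g)"
    and "a \<in> carrier (Mat2 q) \<Longrightarrow> linear_op (mat2_act q \<rho> a)"
proof -
  have "linear_op (\<rho> x)" for x
    using assms by (simp add: mat2_ops_def)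
  then show "mat2_act q \<rho> (Z q x) g = \<rho> x g" "mat2_act q \<rho> (scal q c) g = scale_fun c g"
    "mat2_act q \<rho> \<one>\<^bsub>Mat2 q\<^esub> g = g"
    "\<lbrakk>a \<in> carrier (Mat2 q); b \<in> carrier (Mat2 q)\<rbrakk> \<Longrightarrow>
      mat2_act q \<rho> (a \<oplus>\<^bsub>Mat2 q\<^esub> b) g = mat2_act q \<rho> a g + mat2_act q \<rho> b g"
    "\<lbrakk>a \<in> carrier (Mat2 q); b \<in> carrier (Mat2 q)\<rbrakk> \<Longrightarrow>
      mat2_act q \<rho> (a \<otimes>\<^bsub>Mat2 q\<^esub> b) g = mat2_act q \<rho> b (mat2_act q \<rho> a g)"
    "a \<in> carrier (Mat2 q) \<Longrightarrow> linear_op (mat2_act q \<rho> a)"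
    by (auto simp: carrier_Mat2 cls_add cls_mult Z_cls scal_cls one_Mat2 mat2_act_cls[OF assms]
        eval_op_letter eval_op_const eval_op_one eval_op_add eval_op_mult linear_op_eval_op)
qed

section \<open>Tensor products\<close>

locale scalar_extension = A?: ring A + N?: right_module "A\<lparr>carrier := B\<rparr>" N
  for B and N :: "('a, 'n, 'c) rmodule_scheme" and A :: "('a, 'b) ring_scheme" (structure) +
  assumes B_subset: "B \<subseteq> carrier A"
begin

section \<open>The free abelian group on pairs and the subgroup of tensor relations\<close>

lemma tensor_free_simps [simp]:
  "carrier (tensor_free N A) = {u. Poly_Mapping.keys u \<subseteq> carrier N \<times> carrier A}"
  "u \<oplus>\<^bsub>tensor_free N A\<^esub> w = u + w" "\<zero>\<^bsub>tensor_free N A\<^esub> = 0"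
  "u \<triangleleft>\<^bsub>tensor_free N A\<^esub> c = frag_extend (\<lambda>(x, a). frag_of (x, a \<otimes> c)) u"
  by (auto simp: tensor_free_def)

lemma abelian_group_tensor_free: "abelian_group (tensor_free N A)"
proof (rule abelian_groupI)
  fix u assume "u \<in> carrier (tensor_free N A)"
  then show "\<exists>w\<in>carrier (tensor_free N A). w \<oplus>\<^bsub>tensor_free N A\<^esub> u = \<zero>\<^bsub>tensor_free N A\<^esub>"
    by (intro bexI[of _ "- u"]) auto
next
  fix u w assume "u \<in> carrier (tensor_free N A)" "w \<in> carrier (tensor_free N A)"
  then show "u \<oplus>\<^bsub>tensor_free N A\<^esub> w \<in> carrier (tensor_free N A)"
    using keys_add[of u w] by auto
qed (auto simp: add.commute add.assoc)

interpretation F: abelian_group "tensor_free N A"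
  by (rule abelian_group_tensor_free)

lemma minus_tensor_free [simp]:
  assumes "u \<in> carrier (tensor_free N A)"
  shows "\<ominus>\<^bsub>tensor_free N A\<^esub> u = - u"
  using assms by (intro F.minus_equality) auto

lemma diff_tensor_free:
  assumes "u \<in> carrier (tensor_free N A)" "w \<in> carrier (tensor_free N A)"
  shows "u \<ominus>\<^bsub>tensor_free N A\<^esub> w = u - w"
  using minus_tensor_free[OF assms(2)] by (simp add: a_minus_def)

lemma diff_tensor_free_closed:
  assumes "u \<in> carrier (tensor_free N A)" "w \<in> carrier (tensor_free N A)"
  shows "u - w \<in> carrier (tensor_free N A)"
  using F.minus_closed[OF assms] diff_tensor_free[OF assms] by simp

lemma frag_of_in_tensor_free:
  "x \<in> carrier N \<Longrightarrow> a \<in> carrier A \<Longrightarrow> frag_of (x, a) \<in> carrier (tensor_free N A)"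
  by simp

lemma tensor_rels_cases [consumes 1, case_names left right balance]:
  assumes "u \<in> tensor_rels B N A"
  obtains x y a where "x \<in> carrier N" "y \<in> carrier N" "a \<in> carrier A"
      "u = frag_of (x \<oplus>\<^bsub>N\<^esub> y, a) - frag_of (x, a) - frag_of (y, a)"
    | x a b where "x \<in> carrier N" "a \<in> carrier A" "b \<in> carrier A"
      "u = frag_of (x, a \<oplus> b) - frag_of (x, a) - frag_of (x, b)"
    | x r a where "x \<in> carrier N" "r \<in> B" "a \<in> carrier A"
      "u = frag_of (x \<triangleleft>\<^bsub>N\<^esub> r, a) - frag_of (x, r \<otimes> a)"
  using assms unfolding tensor_rels_def
  by (elim UnE CollectE exE conjE) (rule that, assumption+)+

lemma tensor_relsI:
  "\<lbrakk>x \<in> carrier N; y \<in> carrier N; a \<in> carrier A\<rbrakk> \<Longrightarrow>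
    frag_of (x \<oplus>\<^bsub>N\<^esub> y, a) - frag_of (x, a) - frag_of (y, a) \<in> tensor_rels B N A"
  "\<lbrakk>x \<in> carrier N; a \<in> carrier A; b \<in> carrier A\<rbrakk> \<Longrightarrow>
    frag_of (x, a \<oplus> b) - frag_of (x, a) - frag_of (x, b) \<in> tensor_rels B N A"
  "\<lbrakk>x \<in> carrier N; r \<in> B; a \<in> carrier A\<rbrakk> \<Longrightarrow>
    frag_of (x \<triangleleft>\<^bsub>N\<^esub> r, a) - frag_of (x, r \<otimes> a) \<in> tensor_rels B N A"
  unfolding tensor_rels_def by blast+

lemma ract_base_closed: "x \<in> carrier N \<Longrightarrow> r \<in> B \<Longrightarrow> x \<triangleleft>\<^bsub>N\<^esub> r \<in> carrier N"
  using N.ract_closed by simp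

lemma tensor_rels_subset: "tensor_rels B N A \<subseteq> carrier (tensor_free N A)"
proof
  fix u assume "u \<in> tensor_rels B N A"
  then show "u \<in> carrier (tensor_free N A)"
    by (cases rule: tensor_rels_cases)
      (use B_subset ract_base_closed in
        \<open>auto intro!: diff_tensor_free_closed frag_of_in_tensor_free simp del: tensor_free_simps\<close>)
qed

lemma tensor_null_subgroup: "additive_subgroup (tensor_null B N A) (tensor_free N A)"
  unfolding additive_subgroup_def tensor_null_def
  by (rule group.generate_is_subgroup[OF F.a_group]) (use tensor_rels_subset in simp)

lemma tensor_rels_null: "u \<in> tensor_rels B N A \<Longrightarrow> u \<in> tensor_null B N A"
  unfolding tensor_null_def by (rule generate.incl)

text \<open>A set containing 0 and closed under differences is closed under negation and sums, so
  these cases handle all constructors of \<open>generate\<close>.\<close>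

lemma tensor_null_induct [consumes 1, case_names zero rel diff]:
  assumes "u \<in> tensor_null B N A" and "S 0"
    and "\<And>u. u \<in> tensor_rels B N A \<Longrightarrow> S u" and "\<And>u w. S u \<Longrightarrow> S w \<Longrightarrow> S (u - w)"
  shows "S u"
proof -
  have add: "S (u + w)" if "S u" "S w" for u w
    using assms(4)[OF that(1) assms(4)[OF assms(2) that(2)]] by simp
  have "S u" using assms(1) unfolding tensor_null_def
  proof (induction rule: generate.induct)
    case (inv h)
    then have "inv\<^bsub>add_monoid (tensor_free N A)\<^esub> h = - h"
      using tensor_rels_subset minus_tensor_free[of h] unfolding a_inv_def by blast
    then show ?case using assms(4)[OF assms(2) assms(3)[OF inv]] by simp
  qed (use assms add in simp_all)
  then show ?thesis .
qed

text \<open>Acting on the second factor turns each relation into one of the same family. So the set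
  of relations is itself stable, and the subgroup it generates is a submodule.\<close>

lemma ract_tensor_rels:
  assumes "u \<in> tensor_rels B N A" "c \<in> carrier A"
  shows "u \<triangleleft>\<^bsub>tensor_free N A\<^esub> c \<in> tensor_rels B N A"
proof -
  from assms(1) show ?thesis
  proof (cases rule: tensor_rels_cases)
    case (left x y a)
    then have "u \<triangleleft>\<^bsub>tensor_free N A\<^esub> c =
        frag_of (x \<oplus>\<^bsub>N\<^esub> y, a \<otimes> c) - frag_of (x, a \<otimes> c) - frag_of (y, a \<otimes> c)"
      by (simp add: frag_extend_diff)
    with left assms(2) show ?thesis
      using tensor_relsI(1) A.m_closed by metis
  next
    case (right x a b)
    then have "u \<triangleleft>\<^bsub>tensor_free N A\<^esub> c =
        frag_of (x, a \<otimes> c \<oplus> b \<otimes> c) - frag_of (x, a \<otimes> c) - frag_of (x, b \<otimes> c)"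
      using assms(2) by (simp add: frag_extend_diff A.l_distr)
    with right assms(2) show ?thesis
      using tensor_relsI(2) A.m_closed by metis
  next
    case (balance x r a)
    then have "u \<triangleleft>\<^bsub>tensor_free N A\<^esub> c = frag_of (x \<triangleleft>\<^bsub>N\<^esub> r, a \<otimes> c) - frag_of (x, r \<otimes> (a \<otimes> c))"
      using assms(2) B_subset by (simp add: frag_extend_diff A.m_assoc subset_iff)
    with balance assms(2) show ?thesis
      using tensor_relsI(3) A.m_closed by metis
  qed
qed

lemma tensor_null_diff:
  assumes "u \<in> tensor_null B N A" "w \<in> tensor_null B N A" shows "u - w \<in> tensor_null B N A"
proof -
  interpret additive_subgroup "tensor_null B N A" "tensor_free N A"
    by (rule tensor_null_subgroup)
  show ?thesis
    using a_closed[OF assms(1) a_inv_closed[OF assms(2)]] minus_tensor_free[of w] assms(2) a_subset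
    by auto
qed

lemma tensor_null_submodule: "right_submodule (tensor_null B N A) A (tensor_free N A)"
proof (intro right_submodule.intro right_submodule_axioms.intro tensor_null_subgroup)
  fix u c assume "u \<in> tensor_null B N A" and c: "c \<in> carrier A"
  then show "u \<triangleleft>\<^bsub>tensor_free N A\<^esub> c \<in> tensor_null B N A"
  proof (induction rule: tensor_null_induct)
    case zero
    then show ?case
      using additive_subgroup.zero_closed[OF tensor_null_subgroup] by simp
  next
    case (rel u)
    then show ?case
      using ract_tensor_rels[OF _ c] tensor_rels_null by blast
  next
    case (diff u w)
    then show ?case
      using tensor_null_diff by (simp add: frag_extend_diff)
  qed
qed

lemma ract_tensor_free_closed:
  assumes "u \<in> carrier (tensor_free N A)" "c \<in> carrier A"
  shows "u \<triangleleft>\<^bsub>tensor_free N A\<^esub> c \<in> carrier (tensor_free N A)"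
proof -
  have "Poly_Mapping.keys u \<subseteq> carrier N \<times> carrier A" using assms by simp
  then have "Poly_Mapping.keys (frag_extend (\<lambda>(x, a). frag_of (x, a \<otimes> c)) u)
      \<subseteq> carrier N \<times> carrier A"
    using assms(2) by (intro order_trans[OF keys_frag_extend]) auto
  then show ?thesis by simp
qed

interpretation tensor: ract_quotient "tensor_null B N A" A "tensor_free N A"
proof (intro ract_quotient.intro ract_quotient_axioms.intro A.ring_axioms
    abelian_group_tensor_free tensor_null_submodule)
  fix u c d assume u: "u \<in> carrier (tensor_free N A)" and c: "c \<in> carrier A" and d: "d \<in> carrier A"
  have keys: "Poly_Mapping.keys u \<subseteq> carrier N \<times> carrier A" using u by simp
  have zero: "0 \<in> tensor_null B N A"
    using additive_subgroup.zero_closed[OF tensor_null_subgroup] by simp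
  show "u \<triangleleft>\<^bsub>tensor_free N A\<^esub> (c \<otimes> d) \<ominus>\<^bsub>tensor_free N A\<^esub>
      u \<triangleleft>\<^bsub>tensor_free N A\<^esub> c \<triangleleft>\<^bsub>tensor_free N A\<^esub> d \<in> tensor_null B N A"
  proof -
    \<comment> \<open>Multiplicativity holds already in the free group, by associativity in
      \<open>A\<close>.\<close>
    have "u \<triangleleft>\<^bsub>tensor_free N A\<^esub> (c \<otimes> d) = u \<triangleleft>\<^bsub>tensor_free N A\<^esub> c \<triangleleft>\<^bsub>tensor_free N A\<^esub> d"
      using keys by (induction u rule: frag_induction)
        (use c d in \<open>auto simp: frag_extend_diff A.m_assoc\<close>)
    then show ?thesis
      using u c d zero by (simp add: diff_tensor_free ract_tensor_free_closed del: tensor_free_simps)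
  qed
  \<comment> \<open>On a generator \<open>(x, a)\<close> this is a relation of the second family for
    \<open>a \<otimes> c\<close> and \<open>a \<otimes> d\<close>; differences carry it to all
    \<open>u\<close>.\<close>
  have "u \<triangleleft>\<^bsub>tensor_free N A\<^esub> (c \<oplus> d) - (u \<triangleleft>\<^bsub>tensor_free N A\<^esub> c + u \<triangleleft>\<^bsub>tensor_free N A\<^esub> d)
      \<in> tensor_null B N A"
    using keys
  proof (induction u rule: frag_induction)
    case (one y)
    then obtain x a where "y = (x, a)" "x \<in> carrier N" "a \<in> carrier A" by blast
    moreover from this have "frag_of (x, a \<otimes> c \<oplus> a \<otimes> d) - frag_of (x, a \<otimes> c) - frag_of (x, a \<otimes> d)
        \<in> tensor_null B N A"
      using c d by (intro tensor_rels_null tensor_relsI A.m_closed)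
    ultimately show ?case
      using c d by (simp add: A.r_distr diff_diff_eq)
  next
    case (diff u w)
    then show ?case
      using tensor_null_diff[OF diff] by (simp add: frag_extend_diff algebra_simps)
  qed (simp add: zero)
  then show "u \<triangleleft>\<^bsub>tensor_free N A\<^esub> (c \<oplus> d) \<ominus>\<^bsub>tensor_free N A\<^esub>
      (u \<triangleleft>\<^bsub>tensor_free N A\<^esub> c \<oplus>\<^bsub>tensor_free N A\<^esub> u \<triangleleft>\<^bsub>tensor_free N A\<^esub> d) \<in> tensor_null B N A"
    using u c d diff_tensor_free[OF ract_tensor_free_closed F.a_closed[OF ract_tensor_free_closed ract_tensor_free_closed]]
    by (metis A.a_closed tensor_free_simps(2))
next
  fix u assume u: "u \<in> carrier (tensor_free N A)"
  then have keys: "Poly_Mapping.keys u \<subseteq> carrier N \<times> carrier A" by simp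
  have "u \<triangleleft>\<^bsub>tensor_free N A\<^esub> \<one> = u"
    using keys by (induction u rule: frag_induction) (auto simp: frag_extend_diff)
  then show "u \<triangleleft>\<^bsub>tensor_free N A\<^esub> \<one> \<ominus>\<^bsub>tensor_free N A\<^esub> u \<in> tensor_null B N A"
    using u additive_subgroup.zero_closed[OF tensor_null_subgroup]
    by (simp add: diff_tensor_free del: tensor_free_simps(1,4))
qed (simp_all only: ract_tensor_free_closed, simp add: frag_extend_add)

section \<open>Generation and universal property of the tensor product\<close>

lemma right_module_extend_scalars: "right_module A (extend_scalars B N A)"
  unfolding extend_scalars_def by (rule tensor.right_module_rquot)

interpretation E: right_module A "extend_scalars B N A"
  by (rule right_module_extend_scalars)

lemma pure_tensor_closed:
  "x \<in> carrier N \<Longrightarrow> a \<in> carrier A \<Longrightarrow> pure_tensor B N A x a \<in> carrier (extend_scalars B N A)"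
  unfolding extend_scalars_def pure_tensor_def tensor.carrier_rquot
  by (rule imageI) (rule frag_of_in_tensor_free)

lemma pure_tensor_eqI:
  assumes "u \<in> carrier (tensor_free N A)" "w \<in> carrier (tensor_free N A)" "u - w \<in> tensor_rels B N A"
  shows "tensor_null B N A +>\<^bsub>tensor_free N A\<^esub> u = tensor_null B N A +>\<^bsub>tensor_free N A\<^esub> w"
  using assms tensor_rels_null by (simp add: tensor.coset_eq_iff diff_tensor_free)

lemma pure_tensor_balanced:
  assumes "x \<in> carrier N" "r \<in> B" "a \<in> carrier A"
  shows "pure_tensor B N A (x \<triangleleft>\<^bsub>N\<^esub> r) a = pure_tensor B N A x (r \<otimes> a)"
  unfolding pure_tensor_def
  by (rule pure_tensor_eqI)
    (use assms B_subset ract_base_closed tensor_relsI(3) in auto)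

lemma pure_tensor_ract:
  assumes "x \<in> carrier N" "a \<in> carrier A" "c \<in> carrier A"
  shows "pure_tensor B N A x a \<triangleleft>\<^bsub>extend_scalars B N A\<^esub> c = pure_tensor B N A x (a \<otimes> c)"
  unfolding extend_scalars_def pure_tensor_def
  using assms tensor.ract_rquot[of "frag_of (x, a)" c] by simp

lemma extend_scalars_induct [consumes 1, case_names pure diff]:
  assumes "u \<in> carrier (extend_scalars B N A)"
    and pure: "\<And>x a. x \<in> carrier N \<Longrightarrow> a \<in> carrier A \<Longrightarrow> S (pure_tensor B N A x a)"
    and diff: "\<And>u w. \<lbrakk>u \<in> carrier (extend_scalars B N A); w \<in> carrier (extend_scalars B N A);
      S u; S w\<rbrakk> \<Longrightarrow> S (u \<ominus>\<^bsub>extend_scalars B N A\<^esub> w)"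
  shows "S u"
proof -
  let ?c = "\<lambda>w. tensor_null B N A +>\<^bsub>tensor_free N A\<^esub> w"
  have carrier: "?c w \<in> carrier (extend_scalars B N A)" if "w \<in> carrier (tensor_free N A)" for w
    using that unfolding extend_scalars_def tensor.carrier_rquot by blast
  have minus: "?c u \<ominus>\<^bsub>extend_scalars B N A\<^esub> ?c w = ?c (u - w)"
    if u: "u \<in> carrier (tensor_free N A)" and w: "w \<in> carrier (tensor_free N A)" for u w
  proof -
    have uw: "u - w \<in> carrier (tensor_free N A)"
      using F.minus_closed[OF u w] diff_tensor_free[OF u w] by simp
    have "?c (u - w) \<oplus>\<^bsub>extend_scalars B N A\<^esub> ?c w = ?c u"
      unfolding extend_scalars_def using tensor.add_rquot[OF uw w] by simp
    moreover have "x = (x \<oplus>\<^bsub>extend_scalars B N A\<^esub> z) \<ominus>\<^bsub>extend_scalars B N A\<^esub> z"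
      if "x \<in> carrier (extend_scalars B N A)" "z \<in> carrier (extend_scalars B N A)" for x z
      using that by (simp add: a_minus_def E.a_assoc E.r_neg)
    ultimately show ?thesis using carrier[OF uw] carrier[OF w] by metis
  qed
  obtain w where w: "w \<in> carrier (tensor_free N A)" "u = ?c w"
    using assms(1) unfolding extend_scalars_def tensor.carrier_rquot by blast
  \<comment> \<open>The zero coset arises as the difference of a pure tensor with itself.\<close>
  have zero: "S (?c 0)"
  proof -
    have one: "S (pure_tensor B N A \<zero>\<^bsub>N\<^esub> \<zero>)" by (rule pure) auto
    have z: "frag_of (\<zero>\<^bsub>N\<^esub>, \<zero>) \<in> carrier (tensor_free N A)" by simp
    show ?thesis
      using diff[OF carrier[OF z] carrier[OF z]] one minus[OF z z] by (simp add: pure_tensor_def)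
  qed
  have "w \<in> carrier (tensor_free N A) \<and> S (?c w)"
  proof -
    have "Poly_Mapping.keys w \<subseteq> carrier N \<times> carrier A" using w by simp
    then show ?thesis
    proof (induction w rule: frag_induction)
      case (one y)
      then show ?case using pure by (auto simp: pure_tensor_def)
    next
      case (diff u w)
      then show ?case
        using assms(3)[OF carrier carrier] minus F.minus_closed diff_tensor_free by metis
    qed (simp add: zero)
  qed
  with w show ?thesis by simp
qed

text \<open>\<open>h\<close> extends additively to the free abelian group on pairs; the extension
  kills the three families of relations and therefore factors through the quotient.\<close>

lemma extend_scalars_universal:
  fixes h :: "'n \<Rightarrow> 'a \<Rightarrow> 'v::ab_group_add"
  assumes left: "\<And>x y a. \<lbrakk>x \<in> carrier N; y \<in> carrier N; a \<in> carrier A\<rbrakk> \<Longrightarrow>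
      h (x \<oplus>\<^bsub>N\<^esub> y) a = h x a + h y a"
    and right: "\<And>x a b. \<lbrakk>x \<in> carrier N; a \<in> carrier A; b \<in> carrier A\<rbrakk> \<Longrightarrow>
      h x (a \<oplus> b) = h x a + h x b"
    and balanced: "\<And>x r a. \<lbrakk>x \<in> carrier N; r \<in> B; a \<in> carrier A\<rbrakk> \<Longrightarrow>
      h (x \<triangleleft>\<^bsub>N\<^esub> r) a = h x (r \<otimes> a)"
  obtains k where "\<And>x a. \<lbrakk>x \<in> carrier N; a \<in> carrier A\<rbrakk> \<Longrightarrow> k (pure_tensor B N A x a) = h x a"
    and "\<And>u w. \<lbrakk>u \<in> carrier (extend_scalars B N A); w \<in> carrier (extend_scalars B N A)\<rbrakk> \<Longrightarrow>
      k (u \<oplus>\<^bsub>extend_scalars B N A\<^esub> w) = k u + k w"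
proof -
  \<comment> \<open>The additive group of the type, packaged as a record so that the universal
    property of free abelian groups applies.\<close>
  let ?G = "\<lparr>carrier = UNIV, monoid.mult = (+), one = 0\<rparr> :: 'v monoid"
  interpret G: comm_group ?G
    by (rule comm_groupI) (auto simp: add.assoc add.commute intro: exI[of _ "- _"] add.left_inverse)
  obtain t where hom: "t \<in> hom (free_Abelian_group (carrier N \<times> carrier A)) ?G"
    and t_of: "\<And>y. y \<in> carrier N \<times> carrier A \<Longrightarrow> t (frag_of y) = case_prod h y"
    using G.free_Abelian_group_universal[of "case_prod h" "carrier N \<times> carrier A"] by auto
  have t_add: "t (u + w) = t u + t w"
    if "u \<in> carrier (tensor_free N A)" "w \<in> carrier (tensor_free N A)" for u w
    using hom that by (auto simp: hom_def)
  have t0: "t 0 = 0"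
    using t_add[of 0 0] by simp
  have t_diff: "t (u - w) = t u - t w"
    if "u \<in> carrier (tensor_free N A)" "w \<in> carrier (tensor_free N A)" for u w
    using t_add[of "u - w" w] F.minus_closed[OF that] diff_tensor_free[OF that] that by simp
  have rels: "t u = 0" if "u \<in> tensor_rels B N A" for u
    using that
  proof (cases rule: tensor_rels_cases)
    case (left x y a)
    then show ?thesis
      by (simp add: t_diff t_of diff_tensor_free_closed assms frag_of_in_tensor_free
          del: tensor_free_simps)
  next
    case (right x a b)
    then show ?thesis
      by (simp add: t_diff t_of diff_tensor_free_closed assms frag_of_in_tensor_free
          del: tensor_free_simps)
  next
    case (balance x r a)
    moreover have "r \<in> carrier A" using balance B_subset by blast
    ultimately show ?thesis
      by (simp add: t_diff t_of assms frag_of_in_tensor_free ract_base_closed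
          del: tensor_free_simps)
  qed
  have "u \<in> carrier (tensor_free N A) \<and> t u = 0" if "u \<in> tensor_null B N A" for u
    using that
  proof (induction rule: tensor_null_induct)
    case zero
    then show ?case using t0 by simp
  next
    case (rel u)
    then show ?case using rels tensor_rels_subset by blast
  next
    case (diff u w)
    then show ?case
      using t_diff diff_tensor_free_closed by (metis diff_self)
  qed
  then have null: "t u = 0" if "u \<in> tensor_null B N A" for u
    using that by blast
  show ?thesis
  proof (rule tensor.factor_rquot[of t])
    show "t (u \<oplus>\<^bsub>tensor_free N A\<^esub> w) = t u + t w"
      if "u \<in> carrier (tensor_free N A)" "w \<in> carrier (tensor_free N A)" for u w
      using t_add[OF that] by simp
    show "t u = 0" if "u \<in> tensor_null B N A" for u
      using that by (rule null)
  next
    fix k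
    assume k: "\<And>u. u \<in> carrier (tensor_free N A) \<Longrightarrow>
        k (tensor_null B N A +>\<^bsub>tensor_free N A\<^esub> u) = t u"
      and k_add: "\<And>C D. \<lbrakk>C \<in> carrier (rquot (tensor_free N A) (tensor_null B N A));
          D \<in> carrier (rquot (tensor_free N A) (tensor_null B N A))\<rbrakk> \<Longrightarrow>
        k (C \<oplus>\<^bsub>rquot (tensor_free N A) (tensor_null B N A)\<^esub> D) = k C + k D"
    show ?thesis
    proof (rule that)
      show "k (pure_tensor B N A x a) = h x a" if "x \<in> carrier N" "a \<in> carrier A" for x a
        using that k[OF frag_of_in_tensor_free[OF that]] t_of[of "(x, a)"]
        by (simp add: pure_tensor_def)
    qed (use k_add in \<open>simp add: extend_scalars_def\<close>)
  qed
qed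

end

section \<open>The truncated Verma module on coordinate functions\<close>

locale verma_params =
  fixes q lam1 lam2 :: "'k::field" and m :: nat
  assumes root: "primitive_root_of_unity m q" and lam1: "lam1 \<noteq> 0" and lam2: "lam2 \<noteq> 0"
begin

section \<open>Powers of the root of unity\<close>

lemma m_pos: "m > 0" and q_pow_m: "q ^ m = 1"
  using root by (auto simp: primitive_root_of_unity_def)

lemma q_nz: "q \<noteq> 0"
  using q_pow_m m_pos by (auto simp: power_0_left)

lemma q_pow_eq_1: "q ^ n = 1 \<longleftrightarrow> m dvd n"
proof -
  have "q ^ n = (q ^ m) ^ (n div m) * q ^ (n mod m)"
    by (simp flip: power_mult power_add)
  then have "q ^ n = q ^ (n mod m)"
    by (simp add: q_pow_m)
  moreover have "q ^ (n mod m) = 1 \<longleftrightarrow> n mod m = 0"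
    using root m_pos by (auto simp: primitive_root_of_unity_def)
  ultimately show ?thesis
    by (simp add: dvd_eq_mod_eq_0)
qed

lemma q_pow_inj:
  assumes "a < m" "a' < m" "q ^ a = q ^ a'" shows "a = a'"
proof -
  have "i = j" if "i \<le> j" "j < m" "q ^ i = q ^ j" for i j
  proof -
    have "q ^ j = q ^ i * q ^ (j - i)"
      using \<open>i \<le> j\<close> by (simp flip: power_add)
    then have "q ^ (j - i) = 1"
      using that q_nz by simp
    then have "m dvd j - i"
      by (simp add: q_pow_eq_1)
    then show ?thesis
      using that by (metis diff_is_0_eq dvd_imp_le gr0I le_antisym less_imp_diff_less not_le)
  qed
  then show ?thesis
    using assms by (metis nat_le_linear)
qed

text \<open>
  The function \<open>g\<close> stands for \<open>\<Sum> g (a, b) f(a, b)\<close>, where \<open>f(a, b)\<close> is read as \<open>0\<close> for \<open>b \<ge> n\<close>.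
\<close>

fun verma_op :: "nat \<Rightarrow> gen \<Rightarrow> (nat \<times> nat \<Rightarrow> 'k) \<Rightarrow> nat \<times> nat \<Rightarrow> 'k"
  where "verma_op n G11 g = (\<lambda>(a, b).
      if a = 0 then lam2 * lam1 * q ^ (m - 1) * (q ^ (b + 1) - 1) * g (m - 1, b + 1)
      else if a < m then lam1 * q ^ (a - 1) * (q ^ (b + 1) - 1) * g (a - 1, b + 1) else 0)"
  | "verma_op n G12 g = (\<lambda>(a, b). if b < n then lam1 * q ^ (a + b) * g (a, b) else 0)"
  | "verma_op n G21 g = (\<lambda>(a, b).
      if a = 0 then lam2 * g (m - 1, b) else if a < m then g (a - 1, b) else 0)"
  | "verma_op n G22 g = (\<lambda>(a, b). if 0 < b \<and> b < n then g (a, b - 1) else 0)"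

text \<open>Cutting off at row \<open>n\<close> is compatible with \<open>Z\<^sub>1\<^sub>1\<close>
  because its coefficient \<open>q ^ (b + 1) - 1\<close> vanishes exactly where it would read row
  \<open>n\<close>. This rests on \<open>m dvd n\<close> and is the reason for cutting at multiples
  of \<open>m\<close>.\<close>

lemma verma_op_relations:
  assumes "m dvd n" shows "mat2_ops q (verma_op n)"
proof -
  have qn: "q ^ n = 1"
    using assms by (simp add: q_pow_eq_1)
  have ql: "q ^ (m - Suc 0) = 1 / q"
    using q_pow_m m_pos q_nz by (metis One_nat_def power_minus_mult nonzero_eq_divide_eq)
  have edge: "q ^ Suc b = 1" if "n = Suc b" for b
    using qn that by simp
  have lin: "linear_op (verma_op n x)" for x
    by (cases x) (auto simp: linear_op_def fun_eq_iff scale_fun_def algebra_simps)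
  have 1: "verma_op n G11 (verma_op n G12 g) = verma_op n G12 (verma_op n G11 g)" for g
  proof (rule ext, clarify)
    fix a b
    show "verma_op n G11 (verma_op n G12 g) (a, b) = verma_op n G12 (verma_op n G11 g) (a, b)"
    \<comment> \<open>In the top row the left side is zero by truncation and the right side by
      \<open>q ^ n = 1\<close>.\<close>
    proof (cases "n = Suc b")
      case True
      then show ?thesis by (simp add: edge[OF True] del: power_Suc)
    next
      case False
      then show ?thesis
        by (cases a) (auto simp: m_pos ql q_nz field_simps power_add)
    qed
  qed
  have 2: "verma_op n G11 (verma_op n G21 g) = scale_fun q (verma_op n G21 (verma_op n G11 g))" for g
  proof (rule ext, clarify)
    fix a b
    show "verma_op n G11 (verma_op n G21 g) (a, b) =
        scale_fun q (verma_op n G21 (verma_op n G11 g)) (a, b)"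
    \<comment> \<open>For \<open>m = 1\<close> the columns \<open>0\<close> and \<open>m - 1\<close>
      coincide and \<open>q = 1\<close>. Otherwise wrapping around from column 0 reaches column
      \<open>m - 2\<close>, whose coefficient involves
      \<open>q ^ (m - 2) = 1 / q / q\<close>.\<close>
    proof (cases "m = 1")
      case True
      then have "q ^ k = 1" for k using q_pow_m by simp
      then show ?thesis by (cases a) (simp_all add: scale_fun_def del: power_Suc)
    next
      case False
      then have "m - Suc 0 \<noteq> 0" using m_pos by simp
      then have m2: "m - Suc 0 = Suc (m - Suc (Suc 0))" by simp
      then have q2: "q ^ (m - Suc (Suc 0)) = 1 / q / q"
        using ql q_nz by (simp add: field_simps)
      show ?thesis
        by (cases a; cases "a - 1") (auto simp: m_pos m2 q2 scale_fun_def q_nz field_simps)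
    qed
  qed
  have 3: "verma_op n G21 (verma_op n G22 g) = verma_op n G22 (verma_op n G21 g)" for g
    by (auto simp: fun_eq_iff)
  have 4: "verma_op n G12 (verma_op n G22 g) = scale_fun q (verma_op n G22 (verma_op n G12 g))" for g
    by (auto simp: fun_eq_iff scale_fun_def simp flip: power_Suc)
  have 5: "verma_op n G12 (verma_op n G21 g) = scale_fun q (verma_op n G21 (verma_op n G12 g))" for g
  proof (rule ext, clarify)
    fix a b
    show "verma_op n G12 (verma_op n G21 g) (a, b) =
        scale_fun q (verma_op n G21 (verma_op n G12 g)) (a, b)"
      by (cases a) (auto simp: m_pos scale_fun_def ql q_nz field_simps power_add)
  qed
  have 6: "verma_op n G11 (verma_op n G22 g) =
      verma_op n G22 (verma_op n G11 g) + scale_fun (q - 1) (verma_op n G21 (verma_op n G12 g))" for g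
  proof (rule ext, clarify)
    fix a b
    show "verma_op n G11 (verma_op n G22 g) (a, b) =
      (verma_op n G22 (verma_op n G11 g) + scale_fun (q - 1) (verma_op n G21 (verma_op n G12 g))) (a, b)"
    \<comment> \<open>In the top row the left side is zero by truncation. On the right, up to a
      common factor, the coefficients \<open>q ^ (n - 1) - 1\<close> and
      \<open>(q - 1) * q ^ (n - 1)\<close> add up to \<open>q ^ n - 1 = 0\<close>.\<close>
    proof (cases "n = Suc b")
      case True
      show ?thesis
      proof (cases b)
        case 0
        with edge[OF True] have q1: "q = 1" by simp
        from True 0 show ?thesis
          by (cases a; simp add: scale_fun_def) (simp_all add: q1)
      next
        case (Suc b')
        then have qb: "q ^ b' = 1 / q / q"
          using edge[OF True] q_nz by (simp add: field_simps)
        from True Suc show ?thesis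
          by (cases a) (auto simp: qb m_pos scale_fun_def ql q_nz field_simps power_add)
      qed
    next
      case False
      then show ?thesis
        by (cases a; cases b) (auto simp: m_pos scale_fun_def ql q_nz field_simps power_add)
    qed
  qed
  show ?thesis
    using lin 1 2 3 4 5 6 by (simp only: mat2_ops_def simp_thms)
qed

section \<open>Rows of coordinates and the bottom row of the top block\<close>

definition unit_fun :: "nat \<Rightarrow> nat \<Rightarrow> nat \<times> nat \<Rightarrow> 'k"
  where "unit_fun a b = (\<lambda>i. if i = (a, b) then 1 else 0)"

lemma verma_op_unit_fun:
  "n > 0 \<Longrightarrow> verma_op n G11 (unit_fun 0 0) = 0"
  "b < n \<Longrightarrow> verma_op n G12 (unit_fun a b) = scale_fun (lam1 * q ^ (a + b)) (unit_fun a b)"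
  "Suc a < m \<Longrightarrow> verma_op n G21 (unit_fun a b) = unit_fun (Suc a) b"
  "verma_op n G21 (unit_fun (m - 1) b) = scale_fun lam2 (unit_fun 0 b)"
  "verma_op n G22 (unit_fun a b) = (if Suc b < n then unit_fun a (Suc b) else 0)"
  using m_pos by (auto simp: fun_eq_iff unit_fun_def scale_fun_def)

definition row_fun :: "nat \<Rightarrow> (nat \<Rightarrow> 'k) \<Rightarrow> nat \<times> nat \<Rightarrow> 'k"
  where "row_fun b c = (\<lambda>(i, j). if j = b \<and> i < m then c i else 0)"

lemma verma_op_G22_pow:
  assumes "\<And>a b. b \<ge> n \<Longrightarrow> g (a, b) = 0"
  shows "(verma_op n G22 ^^ k) g (a, b) = (if k \<le> b \<and> b < n then g (a, b - k) else 0)"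
  using assms by (induction k arbitrary: b) auto

lemma verma_op_row_fun:
  "b > 0 \<Longrightarrow> verma_op n G11 (row_fun b c) = row_fun (b - 1)
    (\<lambda>a. if a = 0 then lam2 * lam1 * q ^ (m - 1) * (q ^ b - 1) * c (m - 1)
      else lam1 * q ^ (a - 1) * (q ^ b - 1) * c (a - 1))"
  "b < n \<Longrightarrow> verma_op n G12 (row_fun b c) = row_fun b (\<lambda>a. lam1 * q ^ (a + b) * c a)"
  using m_pos by (auto simp: fun_eq_iff row_fun_def)

text \<open>\<open>I\<close> stands for the coordinate image of a nonzero submodule. Row
  \<open>n - m\<close> is as far down as \<open>Z\<^sub>1\<^sub>1\<close> reaches from the top row:
  on the rows strictly between \<open>n - m\<close> and \<open>n\<close> its factor
  \<open>q ^ b - 1\<close> is nonzero, and on row \<open>n - m\<close> it vanishes.\<close>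

lemma top_unit_fun_mem:
  assumes "n = p * m" and "p > 0"
    and add: "\<And>f g. f \<in> I \<Longrightarrow> g \<in> I \<Longrightarrow> f + g \<in> I"
    and scale: "\<And>c g. g \<in> I \<Longrightarrow> scale_fun c g \<in> I"
    and op: "\<And>x g. g \<in> I \<Longrightarrow> verma_op n x g \<in> I"
    and g: "g \<in> I" "g \<noteq> 0" "\<And>a b. a \<ge> m \<or> b \<ge> n \<Longrightarrow> g (a, b) = 0"
  shows "unit_fun 0 (n - m) \<in> I"
proof -
  have n: "m \<le> n" "m dvd n"
    using assms(1,2) by auto
  define S where "S b \<longleftrightarrow> (\<exists>c. (\<exists>a<m. c a \<noteq> 0) \<and> row_fun b c \<in> I)" for b
  have "S (n - 1)"
  proof -
    obtain a1 b1 where nz: "g (a1, b1) \<noteq> 0"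
      using g(2) by (auto simp: fun_eq_iff)
    \<comment> \<open>The lowest row met by \<open>g\<close>. Shifting it up to row
      \<open>n - 1\<close> by \<open>Z\<^sub>2\<^sub>2\<close> pushes all higher rows past the cut,
      so a single row remains.\<close>
    define b where "b = (LEAST b. \<exists>a. g (a, b) \<noteq> 0)"
    have "\<exists>a. g (a, b) \<noteq> 0"
      unfolding b_def by (rule LeastI[of _ b1]) (use nz in blast)
    then obtain a where a: "g (a, b) \<noteq> 0" by blast
    have less: "g (a', b') = 0" if "b' < b" for a' b'
      using not_less_Least[of b' "\<lambda>b. \<exists>a. g (a, b) \<noteq> 0"] that by (auto simp: b_def)
    have bn: "a < m" "b < n"
      using g(3)[of a b] a by force+
    have mem: "(verma_op n G22 ^^ k) g \<in> I" for k
      by (induction k) (simp_all add: g op del: verma_op.simps)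
    have "(verma_op n G22 ^^ (n - 1 - b)) g = row_fun (n - 1) (\<lambda>a. g (a, b))"
    proof (rule ext, clarify)
      fix i j
      show "(verma_op n G22 ^^ (n - 1 - b)) g (i, j) = row_fun (n - 1) (\<lambda>a. g (a, b)) (i, j)"
        using bn less[of "j - (n - 1 - b)" i] g(3)[of i b]
        by (subst verma_op_G22_pow) (auto simp: g(3) row_fun_def)
    qed
    with mem[of "n - 1 - b"] a bn show ?thesis
      unfolding S_def by auto
  qed
  moreover have "S (b - 1)" if "S b" "0 < b" "\<not> m dvd b" for b
  proof -
    obtain c a where c: "row_fun b c \<in> I" "a < m" "c a \<noteq> 0"
      using \<open>S b\<close> unfolding S_def by blast
    have last: "\<not> a + 1 < m \<Longrightarrow> m - Suc 0 = a"
      using c(2) by simp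
    have qb: "q ^ b - 1 \<noteq> 0"
      using that by (simp add: q_pow_eq_1)
    show ?thesis
      unfolding S_def
    proof (intro exI conjI)
      show "row_fun (b - 1) (\<lambda>a. if a = 0 then lam2 * lam1 * q ^ (m - 1) * (q ^ b - 1) * c (m - 1)
          else lam1 * q ^ (a - 1) * (q ^ b - 1) * c (a - 1)) \<in> I"
        using op[OF c(1), of G11] verma_op_row_fun(1)[OF \<open>0 < b\<close>] by simp
      \<comment> \<open>\<open>Z\<^sub>1\<^sub>1\<close> moves column \<open>a\<close> to
        \<open>a + 1\<close> and the last column back to 0; this is the column in which the nonzero
        entry \<open>c a\<close> lands.\<close>
      show "(if a + 1 < m then a + 1 else 0) < m"
        using m_pos by simp
      show "(if (if a + 1 < m then a + 1 else 0) = 0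
          then lam2 * lam1 * q ^ (m - 1) * (q ^ b - 1) * c (m - 1)
          else lam1 * q ^ ((if a + 1 < m then a + 1 else 0) - 1) * (q ^ b - 1) *
            c ((if a + 1 < m then a + 1 else 0) - 1)) \<noteq> 0"
        using c qb lam1 lam2 q_nz last by (cases "a + 1 < m") auto
    qed
  qed
  then have step: "S (n - 1 - Suc j)" if "S (n - 1 - j)" "Suc j < m" for j
  proof -
    have "n - 1 - j = n - Suc j" "n - 1 - Suc j = n - 1 - j - 1" by auto
    \<comment> \<open>Since \<open>Suc j < m\<close>, the number \<open>n - Suc j\<close> lies
      strictly between the consecutive multiples \<open>n - m\<close> and \<open>n\<close>.\<close>
    moreover have "\<not> m dvd n - Suc j"
      using that n by (metis Suc_lessD dvd_diffD1 dvd_imp_le less_le_trans not_less zero_less_Suc order.strict_implies_order)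
    ultimately show ?thesis
      using \<open>\<And>b. S b \<Longrightarrow> 0 < b \<Longrightarrow> \<not> m dvd b \<Longrightarrow> S (b - 1)\<close>[of "n - 1 - j"] that n by simp
  qed
  ultimately have "j < m \<Longrightarrow> S (n - 1 - j)" for j
    by (induction j) auto
  from this[of "m - 1"] have "S (n - m)"
    using m_pos n by simp
  define B where "B = n - m"
  have B: "B < n" using n m_pos by (simp add: B_def)
  \<comment> \<open>Among the nonzero elements of \<open>I\<close> in row \<open>B\<close>, one with fewest nonzero entries has just one:
    otherwise \<open>Z\<^sub>1\<^sub>2\<close> minus an eigenvalue kills exactly one entry.\<close>
  define nz where "nz c = card {a. a < m \<and> c a \<noteq> 0}" for c :: "nat \<Rightarrow> 'k"
  have "\<exists>c. (\<exists>a<m. c a \<noteq> 0) \<and> row_fun B c \<in> I"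
    using \<open>S (n - m)\<close> unfolding S_def B_def .
  then obtain c where c: "(\<exists>a<m. c a \<noteq> 0) \<and> row_fun B c \<in> I"
    and least: "\<And>d. (\<exists>a<m. d a \<noteq> 0) \<and> row_fun B d \<in> I \<Longrightarrow> nz c \<le> nz d"
    using ex_has_least_nat[of "\<lambda>c. (\<exists>a<m. c a \<noteq> 0) \<and> row_fun B c \<in> I" _ nz] by blast
  obtain a where a: "a < m" "c a \<noteq> 0"
    using c by blast
  have single: "c a' = 0" if "a' < m" "a' \<noteq> a" for a'
  proof (rule ccontr)
    assume "c a' \<noteq> 0"
    define d where "d i = lam1 * q ^ B * (q ^ i - q ^ a) * c i" for i
    have "row_fun B d = verma_op n G12 (row_fun B c) + scale_fun (- (lam1 * q ^ (a + B))) (row_fun B c)"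
      unfolding verma_op_row_fun(2)[OF B]
      by (auto simp: fun_eq_iff row_fun_def d_def scale_fun_def algebra_simps power_add)
    then have "row_fun B d \<in> I"
      using c op add scale by metis
    moreover have "d a' \<noteq> 0"
      using q_pow_inj[OF that(1) a(1)] that lam1 q_nz \<open>c a' \<noteq> 0\<close> by (auto simp: d_def)
    ultimately have "nz c \<le> nz d"
      using least that by blast
    moreover have "{i. i < m \<and> d i \<noteq> 0} \<subset> {i. i < m \<and> c i \<noteq> 0}"
      using a by (auto simp: d_def)
    then have "nz d < nz c"
      unfolding nz_def by (intro psubset_card_mono) auto
    ultimately show False by simp
  qed
  have "scale_fun (inverse (c a)) (row_fun B c) = unit_fun a B"
    using a single by (auto simp: fun_eq_iff row_fun_def unit_fun_def scale_fun_def)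
  then have unit: "unit_fun a B \<in> I"
    using c scale by metis
  \<comment> \<open>Rotating by \<open>Z\<^sub>2\<^sub>1\<close> ends in column
    \<open>m - 1\<close>, from where one more application wraps to column 0 with the invertible
    factor \<open>lam2\<close>.\<close>
  have "unit_fun (m - 1) B \<in> I"
  proof -
    have "unit_fun i B \<in> I \<Longrightarrow> unit_fun (Suc i) B \<in> I" if "Suc i < m" for i
      using op[of "unit_fun i B" G21] verma_op_unit_fun(3)[OF that] by metis
    then have "unit_fun (a + k) B \<in> I" if "a + k < m" for k
      using that unit by (induction k) auto
    from this[of "m - 1 - a"] show ?thesis using a by simp
  qed
  then have "scale_fun (inverse lam2) (scale_fun lam2 (unit_fun 0 B)) \<in> I"
    using op[of _ G21] verma_op_unit_fun(4) scale by metis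
  then show ?thesis
    using lam2 by (simp add: scale_fun_simps B_def)
qed

end

section \<open>The base module and its character\<close>

lemma Z_in_carrier [simp]: "Z q g \<in> carrier (Mat2 q)"
  by (simp add: Z_cls)

lemma Z_pow_in_carrier [simp]: "Z q g [^]\<^bsub>Mat2 q\<^esub> (n::nat) \<in> carrier (Mat2 q)"
  by (simp add: Z_cls pow_cls)

lemma mat2_act_closed:
  assumes "mat2_ops q \<rho>" "a \<in> carrier (Mat2 q)" "g \<in> I"
    and "\<And>f g. f \<in> I \<Longrightarrow> g \<in> I \<Longrightarrow> f + g \<in> I"
    and "\<And>c g. g \<in> I \<Longrightarrow> scale_fun c g \<in> I"
    and "\<And>x g. g \<in> I \<Longrightarrow> \<rho> x g \<in> I"
  shows "mat2_act q \<rho> a g \<in> I"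
  using assms(2,3)
  by (induction arbitrary: g rule: Mat2_induct)
    (auto simp: mat2_act_simps[OF assms(1)] assms(4-6))

lemma right_module_subring:
  assumes "right_module R M" "subring S R"
  shows "right_module (R\<lparr>carrier := S\<rparr>) M"
proof -
  interpret right_module R M by fact
  have "S \<subseteq> carrier R"
    using assms(2) by (rule subringE)
  moreover have "ring (R\<lparr>carrier := S\<rparr>)"
    using assms(2) R.subring_is_ring by blast
  ultimately show ?thesis
    using M.abelian_group_axioms
    by (intro right_module.intro right_module_axioms.intro)
      (auto simp: subset_iff ract_closed ract_add_left ract_add_right ract_mult ract_one)
qed

lemma scal_simps:
  "scal q c \<in> carrier (Mat2 q)"
  "scal q (c + d) = scal q c \<oplus>\<^bsub>Mat2 q\<^esub> scal q d"
  "scal q (c * d) = scal q c \<otimes>\<^bsub>Mat2 q\<^esub> scal q d"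
  "scal q 1 = \<one>\<^bsub>Mat2 q\<^esub>" "scal q 0 = \<zero>\<^bsub>Mat2 q\<^esub>"
  by (simp_all add: scal_cls const_simps cls_add cls_mult one_Mat2 zero_Mat2)

text \<open>With negation expressed as a scalar multiple, closure under scalars and products also
  covers additive inverses.\<close>

lemma scal_minus: "\<ominus>\<^bsub>Mat2 q\<^esub> cls q P = scal q (- 1) \<otimes>\<^bsub>Mat2 q\<^esub> cls q P"
proof -
  interpret ring "Mat2 q" by (rule ring_Mat2)
  have "const (- 1) + 1 = (0 :: (gen, 'a) free_algebra)"
    using const_simps(1,2) const_simps(3)[of "- 1 :: 'a" 1] by (metis add.left_inverse)
  then have "const (- 1) * P + P = 0"
    by (metis distrib_right mult_1 mult_zero_left)
  then show ?thesis
    by (intro minus_equality) (simp_all add: scal_cls cls_mult cls_add zero_Mat2)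
qed

lemma scal_subring: "subring (range (scal q)) (Mat2 q)"
proof -
  interpret ring "Mat2 q" by (rule ring_Mat2)
  show ?thesis
  proof (rule subringI)
    fix h assume "h \<in> range (scal q)"
    then obtain c where "h = scal q c" by blast
    then have "\<ominus>\<^bsub>Mat2 q\<^esub> h = scal q (- 1 * c)"
      using scal_minus[of q "const c"] scal_simps(3)[of q "- 1" c] by (simp only: scal_cls)
    then show "\<ominus>\<^bsub>Mat2 q\<^esub> h \<in> range (scal q)" by blast
  qed (auto simp: scal_simps(1) simp flip: scal_simps(2-4))
qed

locale mat2_module = right_module "Mat2 q" V
  for q :: "'k::field" and V :: "((gen, 'k) free_algebra set, 'v) rmodule"
begin

text \<open>The relations as rules bringing \<open>Z\<^sub>1\<^sub>1\<close> and
  \<open>Z\<^sub>1\<^sub>2\<close> leftward past \<open>Z\<^sub>2\<^sub>1\<close> and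
  \<open>Z\<^sub>2\<^sub>2\<close>, towards the vector acted on. Scalars are collected at the right
  end, which is possible because they are central.\<close>

lemma ract_generators:
  assumes "u \<in> carrier V"
  shows "u \<triangleleft>\<^bsub>V\<^esub> Z q G22 \<triangleleft>\<^bsub>V\<^esub> Z q G21 = u \<triangleleft>\<^bsub>V\<^esub> Z q G21 \<triangleleft>\<^bsub>V\<^esub> Z q G22"
    and "u \<triangleleft>\<^bsub>V\<^esub> Z q G21 \<triangleleft>\<^bsub>V\<^esub> Z q G11 = u \<triangleleft>\<^bsub>V\<^esub> Z q G11 \<triangleleft>\<^bsub>V\<^esub> Z q G21 \<triangleleft>\<^bsub>V\<^esub> scal q q"
    and "u \<triangleleft>\<^bsub>V\<^esub> Z q G22 \<triangleleft>\<^bsub>V\<^esub> Z q G12 = u \<triangleleft>\<^bsub>V\<^esub> Z q G12 \<triangleleft>\<^bsub>V\<^esub> Z q G22 \<triangleleft>\<^bsub>V\<^esub> scal q q"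
    and "u \<triangleleft>\<^bsub>V\<^esub> Z q G21 \<triangleleft>\<^bsub>V\<^esub> Z q G12 = u \<triangleleft>\<^bsub>V\<^esub> Z q G12 \<triangleleft>\<^bsub>V\<^esub> Z q G21 \<triangleleft>\<^bsub>V\<^esub> scal q q"
    and "u \<triangleleft>\<^bsub>V\<^esub> Z q G22 \<triangleleft>\<^bsub>V\<^esub> Z q G11 = u \<triangleleft>\<^bsub>V\<^esub> Z q G11 \<triangleleft>\<^bsub>V\<^esub> Z q G22 \<oplus>\<^bsub>V\<^esub>
      u \<triangleleft>\<^bsub>V\<^esub> Z q G12 \<triangleleft>\<^bsub>V\<^esub> Z q G21 \<triangleleft>\<^bsub>V\<^esub> scal q (q - 1)"
    and "a \<in> carrier (Mat2 q) \<Longrightarrow> u \<triangleleft>\<^bsub>V\<^esub> scal q c \<triangleleft>\<^bsub>V\<^esub> a = u \<triangleleft>\<^bsub>V\<^esub> a \<triangleleft>\<^bsub>V\<^esub> scal q c"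
  using assms
  by (auto simp: Z_cls scal_cls carrier_Mat2 cls_mult cls_add Mat2_relations ract_closed
      mult.assoc const_commutes simp flip: ract_mult ract_add_right)

end

section \<open>The character of the subalgebra \<open>B_alg q m\<close>\<close>

context verma_params
begin

text \<open>For \<open>a\<close> in \<open>B_alg q m\<close> this is the eigenvalue on the base
  vector, read off in the smallest truncation \<open>n = m\<close>. By \<open>act_B_alg\<close>
  every other truncation gives the same value.\<close>

definition chi :: "(gen, 'k) free_algebra set \<Rightarrow> 'k"
  where "chi a = mat2_act q (verma_op m) a (unit_fun 0 0) (0, 0)"

lemma B_gens: "range (scal q) \<union> {Z q G11, Z q G12, Z q G21 [^]\<^bsub>Mat2 q\<^esub> m} \<subseteq> carrier (Mat2 q)"
  by (auto simp: Z_cls scal_cls pow_cls)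

lemma B_alg_subring: "subring (B_alg q m) (Mat2 q)"
  unfolding B_alg_def by (rule ring.generate_ring_is_subring[OF ring_Mat2 B_gens])

lemma B_alg_subset: "B_alg q m \<subseteq> carrier (Mat2 q)"
  by (rule subringE(1)[OF B_alg_subring])

lemma B_alg_gen:
  "scal q c \<in> B_alg q m" "Z q G11 \<in> B_alg q m" "Z q G12 \<in> B_alg q m"
  "Z q G21 [^]\<^bsub>Mat2 q\<^esub> m \<in> B_alg q m"
  unfolding B_alg_def by (auto intro: generate_ring.incl)

lemma B_alg_induct [consumes 1, case_names scal Z11 Z12 Z21 add mult]:
  assumes "a \<in> B_alg q m" "\<And>c. S (scal q c)" "S (Z q G11)" "S (Z q G12)"
    "S (Z q G21 [^]\<^bsub>Mat2 q\<^esub> m)"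
    and add: "\<And>a b. a \<in> B_alg q m \<Longrightarrow> b \<in> B_alg q m \<Longrightarrow> S a \<Longrightarrow> S b \<Longrightarrow> S (a \<oplus>\<^bsub>Mat2 q\<^esub> b)"
    and mult: "\<And>a b. a \<in> B_alg q m \<Longrightarrow> b \<in> B_alg q m \<Longrightarrow> S a \<Longrightarrow> S b \<Longrightarrow> S (a \<otimes>\<^bsub>Mat2 q\<^esub> b)"
  shows "S a"
  using assms(1) unfolding B_alg_def
proof (induction rule: generate_ring.induct)
  case one
  show ?case using assms(2)[of 1] by (simp add: scal_simps)
next
  case (incl h)
  then show ?case using assms(2-5) by auto
next
  case (a_inv h)
  then have "h \<in> B_alg q m" by (simp add: B_alg_def)
  moreover from this obtain P where "h = cls q P"
    using B_alg_subset by (auto simp: carrier_Mat2)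
  ultimately show ?case
    using mult[of "scal q (- 1)" h] a_inv assms(2) B_alg_gen scal_minus[of q P] by simp
next
  case (eng_add h1 h2)
  then show ?case using add by (simp add: B_alg_def)
next
  case (eng_mult h1 h2)
  then show ?case using mult by (simp add: B_alg_def)
qed

lemma act_Z21_pow:
  assumes "m dvd n" "k < m"
  shows "mat2_act q (verma_op n) (Z q G21 [^]\<^bsub>Mat2 q\<^esub> k) (unit_fun 0 b) = unit_fun k b"
  using assms(2)
proof (induction k)
  case 0
  show ?case
    by (simp add: mat2_act_simps[OF verma_op_relations[OF assms(1)]])
next
  case (Suc k)
  then show ?case
    using verma_op_unit_fun(3)[OF Suc.prems]
    by (simp add: mat2_act_simps[OF verma_op_relations[OF assms(1)]] del: verma_op.simps)
qed

lemma act_Z21_pow_m: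
  assumes "m dvd n"
  shows "mat2_act q (verma_op n) (Z q G21 [^]\<^bsub>Mat2 q\<^esub> m) (unit_fun 0 b) = scale_fun lam2 (unit_fun 0 b)"
proof -
  have "Z q G21 [^]\<^bsub>Mat2 q\<^esub> m = Z q G21 [^]\<^bsub>Mat2 q\<^esub> (m - 1) \<otimes>\<^bsub>Mat2 q\<^esub> Z q G21"
    using m_pos by (cases m) simp_all
  then show ?thesis
    using m_pos act_Z21_pow[OF assms, of "m - 1"] verma_op_unit_fun(4)
    by (simp add: mat2_act_simps[OF verma_op_relations[OF assms]] del: verma_op.simps)
qed

lemma act_B_alg:
  assumes "a \<in> B_alg q m" "m dvd n" "n > 0"
  shows "mat2_act q (verma_op n) a (unit_fun 0 0) = scale_fun (chi a) (unit_fun 0 0)"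
proof -
  \<comment> \<open>The eigenvalue is chosen before \<open>n\<close>, so that specializing to
    \<open>n = m\<close> identifies it with \<open>chi a\<close>.\<close>
  have "\<exists>c. \<forall>n. m dvd n \<and> n > 0 \<longrightarrow>
      mat2_act q (verma_op n) a (unit_fun 0 0) = scale_fun c (unit_fun 0 0)"
    using assms(1)
  proof (induction rule: B_alg_induct)
    case (scal c)
    show ?case
      by (intro exI[of _ c]) (simp add: mat2_act_simps[OF verma_op_relations])
  next
    case Z11
    show ?case
      by (intro exI[of _ 0])
        (simp add: mat2_act_simps[OF verma_op_relations] verma_op_unit_fun scale_fun_simps del: verma_op.simps)
  next
    case Z12
    show ?case
      by (intro exI[of _ lam1])
        (simp add: mat2_act_simps[OF verma_op_relations] verma_op_unit_fun del: verma_op.simps)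
  next
    case Z21
    show ?case
      by (intro exI[of _ lam2]) (simp add: act_Z21_pow_m)
  next
    case (add a b)
    then obtain c d where "\<forall>n. m dvd n \<and> n > 0 \<longrightarrow>
        mat2_act q (verma_op n) a (unit_fun 0 0) = scale_fun c (unit_fun 0 0)"
      "\<forall>n. m dvd n \<and> n > 0 \<longrightarrow>
        mat2_act q (verma_op n) b (unit_fun 0 0) = scale_fun d (unit_fun 0 0)" by blast
    moreover have "a \<in> carrier (Mat2 q)" "b \<in> carrier (Mat2 q)"
      using add B_alg_subset by auto
    ultimately show ?case
      by (intro exI[of _ "c + d"])
        (simp add: mat2_act_simps[OF verma_op_relations] scale_fun_simps(2))
  next
    case (mult a b)
    then obtain c d where "\<forall>n. m dvd n \<and> n > 0 \<longrightarrow>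
        mat2_act q (verma_op n) a (unit_fun 0 0) = scale_fun c (unit_fun 0 0)"
      "\<forall>n. m dvd n \<and> n > 0 \<longrightarrow>
        mat2_act q (verma_op n) b (unit_fun 0 0) = scale_fun d (unit_fun 0 0)" by blast
    moreover have carr: "a \<in> carrier (Mat2 q)" "b \<in> carrier (Mat2 q)"
      using mult B_alg_subset by auto
    moreover have "linear_op (mat2_act q (verma_op n) b)" if "m dvd n" for n
      using carr by (intro mat2_act_simps(6)[OF verma_op_relations] that)
    ultimately show ?case
      by (intro exI[of _ "c * d"])
        (simp add: mat2_act_simps[OF verma_op_relations] linear_op_def scale_fun_simps(3))
  qed
  then obtain c where c: "\<And>n. m dvd n \<Longrightarrow> n > 0 \<Longrightarrow>
      mat2_act q (verma_op n) a (unit_fun 0 0) = scale_fun c (unit_fun 0 0)" by blast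
  moreover have "chi a = c"
    using c[of m] m_pos by (simp add: chi_def scale_fun_def unit_fun_def)
  ultimately show ?thesis using assms by simp
qed

lemma chi_simps:
  "chi (scal q c) = c" "chi (Z q G11) = 0" "chi (Z q G12) = lam1"
  "chi (Z q G21 [^]\<^bsub>Mat2 q\<^esub> m) = lam2"
  "a \<in> B_alg q m \<Longrightarrow> b \<in> B_alg q m \<Longrightarrow> chi (a \<oplus>\<^bsub>Mat2 q\<^esub> b) = chi a + chi b"
  "a \<in> B_alg q m \<Longrightarrow> b \<in> B_alg q m \<Longrightarrow> chi (a \<otimes>\<^bsub>Mat2 q\<^esub> b) = chi a * chi b"
proof -
  note act = mat2_act_simps[OF verma_op_relations[OF dvd_refl]]
  show "chi (scal q c) = c" "chi (Z q G11) = 0" "chi (Z q G12) = lam1"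
    using m_pos by (simp_all add: chi_def act verma_op_unit_fun scale_fun_def del: verma_op.simps)
      (simp_all add: unit_fun_def)
  show "chi (Z q G21 [^]\<^bsub>Mat2 q\<^esub> m) = lam2"
    unfolding chi_def act_Z21_pow_m[OF dvd_refl] by (simp add: scale_fun_def unit_fun_def)
  show "chi (a \<oplus>\<^bsub>Mat2 q\<^esub> b) = chi a + chi b" if "a \<in> B_alg q m" "b \<in> B_alg q m"
    using that B_alg_subset by (simp add: chi_def act subset_iff)
  show "chi (a \<otimes>\<^bsub>Mat2 q\<^esub> b) = chi a * chi b" if "a \<in> B_alg q m" "b \<in> B_alg q m"
  proof -
    have "linear_op (mat2_act q (verma_op m) b)"
      using that B_alg_subset by (intro act(6)) auto
    then have "mat2_act q (verma_op m) (a \<otimes>\<^bsub>Mat2 q\<^esub> b) (unit_fun 0 0) =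
        scale_fun (chi a * chi b) (unit_fun 0 0)"
      using that B_alg_subset m_pos
      by (simp add: act subset_iff act_B_alg linear_op_def scale_fun_simps)
    then show ?thesis
      by (simp add: chi_def scale_fun_def unit_fun_def)
  qed
qed

text \<open>The value \<open>undefined\<close> off \<open>B_alg q m\<close> is the one demanded by
  \<open>extensional\<close>, which makes the action described in \<open>K_lambda\<close>
  unique.\<close>

definition K_act :: "'k \<Rightarrow> (gen, 'k) free_algebra set \<Rightarrow> 'k"
  where "K_act x a = (if a \<in> B_alg q m then x * chi a else undefined)"

lemma K_act_module: "right_module ((Mat2 q)\<lparr>carrier := B_alg q m\<rparr>) (line_rmodule K_act)"
proof (intro right_module.intro right_module_axioms.intro)
  show "ring ((Mat2 q)\<lparr>carrier := B_alg q m\<rparr>)"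
    by (rule ring.subring_is_ring[OF ring_Mat2 B_alg_subring])
  show "abelian_group (line_rmodule K_act)"
    by (rule abelian_groupI)
      (auto simp: line_rmodule_def algebra_simps intro: exI[of _ "- _"] add.left_inverse)
qed (use subringE[OF B_alg_subring] in
    \<open>auto simp: line_rmodule_def K_act_def chi_simps algebra_simps scal_simps(4)[symmetric]\<close>)

text \<open>Existence of the described action is \<open>K_act_module\<close>; uniqueness is
  induction over the generators of \<open>B_alg q m\<close>, which forces
  \<open>act x a = x * chi a\<close>.\<close>

lemma K_lambda_eq: "K_lambda q m lam1 lam2 = line_rmodule K_act"
proof -
  have "(THE act. right_module ((Mat2 q)\<lparr>carrier := B_alg q m\<rparr>) (line_rmodule act) \<and>
     (\<forall>v c. act v (scal q c) = c * v) \<and> (\<forall>v. act v (Z q G11) = 0) \<and>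
     (\<forall>v. act v (Z q G12) = lam1 * v) \<and> (\<forall>v. act v (Z q G21 [^]\<^bsub>Mat2 q\<^esub> m) = lam2 * v) \<and>
     (\<forall>v. act v \<in> extensional (B_alg q m))) = K_act"
  proof (rule the_equality, intro conjI K_act_module)
    fix act :: "'k \<Rightarrow> (gen, 'k) free_algebra set \<Rightarrow> 'k"
    assume act: "right_module ((Mat2 q)\<lparr>carrier := B_alg q m\<rparr>) (line_rmodule act) \<and>
     (\<forall>v c. act v (scal q c) = c * v) \<and> (\<forall>v. act v (Z q G11) = 0) \<and>
     (\<forall>v. act v (Z q G12) = lam1 * v) \<and> (\<forall>v. act v (Z q G21 [^]\<^bsub>Mat2 q\<^esub> m) = lam2 * v) \<and>
     (\<forall>v. act v \<in> extensional (B_alg q m))"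
    then interpret L: right_module "(Mat2 q)\<lparr>carrier := B_alg q m\<rparr>" "line_rmodule act" by blast
    have "act x a = x * chi a" if "a \<in> B_alg q m" for x a
      using that
    proof (induction arbitrary: x rule: B_alg_induct)
      case (add a b)
      then show ?case
        using L.ract_add_right[of x a b] by (simp add: line_rmodule_def chi_simps algebra_simps)
    next
      case (mult a b)
      then show ?case
        using L.ract_mult[of x a b] by (simp add: line_rmodule_def chi_simps algebra_simps)
    qed (use act in \<open>simp_all add: chi_simps\<close>)
    moreover have "act x a = undefined" if "a \<notin> B_alg q m" for x a
      using act that by (auto simp: extensional_def)
    ultimately show "act = K_act"
      by (auto simp: K_act_def fun_eq_iff)
  qed (auto simp: K_act_def B_alg_gen chi_simps extensional_def)
  then show ?thesis by (simp add: K_lambda_def)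
qed

lemma K_lambda_simps [simp]:
  "carrier (K_lambda q m lam1 lam2) = UNIV"
  "x \<oplus>\<^bsub>K_lambda q m lam1 lam2\<^esub> y = x + y"
  "a \<in> B_alg q m \<Longrightarrow> x \<triangleleft>\<^bsub>K_lambda q m lam1 lam2\<^esub> a = x * chi a"
  by (simp_all add: K_lambda_eq line_rmodule_def K_act_def)

lemma scalar_extension: "scalar_extension (B_alg q m) (K_lambda q m lam1 lam2) (Mat2 q)"
  by (intro scalar_extension.intro scalar_extension_axioms.intro ring_Mat2 B_alg_subset)
    (simp add: K_lambda_eq K_act_module)

sublocale X: scalar_extension "B_alg q m" "K_lambda q m lam1 lam2" "Mat2 q"
  rewrites "extend_scalars (B_alg q m) (K_lambda q m lam1 lam2) (Mat2 q) = Verma q m lam1 lam2"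
  by (rule scalar_extension) (simp add: Verma_def)

end

section \<open>The quotients of the Verma module\<close>

locale verma_quotient = verma_params q lam1 lam2 m
  for q lam1 lam2 :: "'k::field" and m :: nat +
  fixes v :: 'k and p :: nat
  assumes v: "v \<noteq> 0" and p: "p > 0"
begin

abbreviation V :: "((gen, 'k) free_algebra set, 'k verma) rmodule"
  where "V \<equiv> Verma q m lam1 lam2"

abbreviation pt :: "'k \<Rightarrow> (gen, 'k) free_algebra set \<Rightarrow> 'k verma"
  where "pt \<equiv> pure_tensor (B_alg q m) (K_lambda q m lam1 lam2) (Mat2 q)"

abbreviation f :: "nat \<Rightarrow> nat \<Rightarrow> 'k verma"
  where "f \<equiv> f_vec q m lam1 lam2 v"

abbreviation act :: "(gen, 'k) free_algebra set \<Rightarrow> (nat \<times> nat \<Rightarrow> 'k) \<Rightarrow> nat \<times> nat \<Rightarrow> 'k"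
  where "act \<equiv> mat2_act q (verma_op (p * m))"

lemma ops: "mat2_ops q (verma_op (p * m))"
  by (rule verma_op_relations) simp

lemmas act_simps = mat2_act_simps[OF ops]

lemma n_pos: "0 < p * m"
  using p m_pos by simp

sublocale V: mat2_module q V
  by (intro mat2_module.intro X.right_module_extend_scalars)

lemma scal_in_carrier [simp]: "scal q c \<in> carrier (Mat2 q)"
  by (rule scal_simps)

lemma pt_closed [simp]: "a \<in> carrier (Mat2 q) \<Longrightarrow> pt x a \<in> carrier V"
  using X.pure_tensor_closed by simp

lemma pt_ract: "a \<in> carrier (Mat2 q) \<Longrightarrow> b \<in> carrier (Mat2 q) \<Longrightarrow> pt x a \<triangleleft>\<^bsub>V\<^esub> b = pt x (a \<otimes>\<^bsub>Mat2 q\<^esub> b)"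
  using X.pure_tensor_ract by simp

lemma pt_balanced:
  assumes "r \<in> B_alg q m" "chi r = c"
  shows "pt x r = pt (x * c) \<one>\<^bsub>Mat2 q\<^esub>"
proof -
  show ?thesis
    using X.pure_tensor_balanced[of x r "\<one>\<^bsub>Mat2 q\<^esub>"] assms B_alg_subset by auto
qed

lemma f_closed [simp]: "f a b \<in> carrier V"
proof -
  show ?thesis by (simp add: f_vec_def)
qed

lemma f_0_0: "f 0 0 = pt v \<one>\<^bsub>Mat2 q\<^esub>"
proof -
  show ?thesis by (simp add: f_vec_def)
qed

lemma f_Suc_right: "f a (Suc b) = f a b \<triangleleft>\<^bsub>V\<^esub> Z q G22"
proof -
  show ?thesis by (simp add: f_vec_def pt_ract X.A.m_assoc)
qed

text \<open>The new \<open>Z\<^sub>2\<^sub>1\<close> acts from the right and commutes past the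
  powers of \<open>Z\<^sub>2\<^sub>2\<close> to join its own kind.\<close>

lemma f_Suc_left: "f (Suc a) b = f a b \<triangleleft>\<^bsub>V\<^esub> Z q G21"
proof (induction b)
  case 0
  show ?case by (simp add: f_vec_def pt_ract)
next
  case (Suc b)
  then show ?case
    by (simp add: f_Suc_right V.ract_generators(1))
qed

lemma f_0_0_ract:
  assumes "r \<in> B_alg q m"
  shows "f 0 0 \<triangleleft>\<^bsub>V\<^esub> r = f 0 0 \<triangleleft>\<^bsub>V\<^esub> scal q (chi r)"
proof -
  have "r \<in> carrier (Mat2 q)" using assms B_alg_subset by blast
  moreover have "pt v r = pt v (scal q (chi r))"
    using pt_balanced[OF assms refl] pt_balanced[OF B_alg_gen(1) chi_simps(1)] by simp
  ultimately show ?thesis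
    by (simp add: f_0_0 pt_ract)
qed

text \<open>For \<open>b = 0\<close> the power of \<open>Z\<^sub>2\<^sub>1\<close> lies in
  \<open>B_alg q m\<close> and passes through the tensor sign as \<open>lam2\<close>;
  \<open>Z\<^sub>2\<^sub>2\<close> carries this to every row. It closes the columns up
  cyclically.\<close>

lemma f_m: "f m b = f 0 b \<triangleleft>\<^bsub>V\<^esub> scal q lam2"
proof (induction b)
  case 0
  have "f m 0 = f 0 0 \<triangleleft>\<^bsub>V\<^esub> (Z q G21 [^]\<^bsub>Mat2 q\<^esub> m)"
    by (simp add: f_vec_def pt_ract)
  then show ?case
    using f_0_0_ract[OF B_alg_gen(4)] by (simp add: chi_simps)
next
  case (Suc b)
  then show ?case
    by (simp add: f_Suc_right V.ract_generators(6))
qed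

text \<open>The right submodules of \<open>V\<close> over this ring are the linear subspaces, so
  \<open>rspan\<close> over it is the linear span.\<close>

definition scal_ring :: "(gen, 'k) free_algebra set ring"
  where "scal_ring = (Mat2 q)\<lparr>carrier := range (scal q)\<rparr>"

lemma carrier_scal_ring [simp]: "carrier scal_ring = range (scal q)"
  by (simp add: scal_ring_def)

sublocale S: right_module scal_ring V
  unfolding scal_ring_def
  by (intro right_module_subring V.right_module_axioms scal_subring)

lemma scal_submodule_mem:
  assumes "right_submodule N scal_ring V"
  shows "x \<in> N \<Longrightarrow> y \<in> N \<Longrightarrow> x \<oplus>\<^bsub>V\<^esub> y \<in> N" "x \<in> N \<Longrightarrow> x \<triangleleft>\<^bsub>V\<^esub> scal q c \<in> N"
    "x \<in> N \<Longrightarrow> x \<in> carrier V" "\<zero>\<^bsub>V\<^esub> \<in> N"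
proof -
  interpret right_submodule N scal_ring V by fact
  show "x \<in> N \<Longrightarrow> y \<in> N \<Longrightarrow> x \<oplus>\<^bsub>V\<^esub> y \<in> N" "x \<in> N \<Longrightarrow> x \<triangleleft>\<^bsub>V\<^esub> scal q c \<in> N"
    "x \<in> N \<Longrightarrow> x \<in> carrier V" "\<zero>\<^bsub>V\<^esub> \<in> N"
    using a_closed ract_closed a_subset zero_closed by auto
qed

section \<open>Spanning of the Verma module by the vectors f(a, b)\<close>

definition f_span :: "'k verma set"
  where "f_span = rspan scal_ring V {f a b | a b. a < m}"

lemma f_span_submodule: "right_submodule f_span scal_ring V"
  unfolding f_span_def by (rule S.rspan_submodule) auto

lemmas f_span_mem = scal_submodule_mem[OF f_span_submodule]

lemma f_in_span: "a < m \<Longrightarrow> f a b \<in> f_span"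
  unfolding f_span_def by (rule subsetD[OF subset_rspan]) blast

lemma f_span_subset:
  assumes "right_submodule N scal_ring V" "\<And>a b. a < m \<Longrightarrow> f a b \<in> N"
  shows "f_span \<subseteq> N"
  unfolding f_span_def using assms(1) by (rule rspan_subset) (auto intro: assms(2))

text \<open>The vectors that \<open>a\<close> sends into \<open>f_span\<close> form a linear
  subspace, because scalars commute with \<open>a\<close>; so testing the spanning vectors
  suffices.\<close>

lemma f_span_stable:
  assumes "a \<in> carrier (Mat2 q)" "\<And>i j. i < m \<Longrightarrow> f i j \<triangleleft>\<^bsub>V\<^esub> a \<in> f_span" "u \<in> f_span"
  shows "u \<triangleleft>\<^bsub>V\<^esub> a \<in> f_span"
proof -
  have "right_submodule {u \<in> carrier V. u \<triangleleft>\<^bsub>V\<^esub> a \<in> f_span} scal_ring V"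
    by (rule S.right_submoduleI)
      (use assms(1) in \<open>auto simp: V.ract_zero_left V.ract_add_left V.ract_generators(6) f_span_mem
        V.ract_closed\<close>)
  then have "f_span \<subseteq> {u \<in> carrier V. u \<triangleleft>\<^bsub>V\<^esub> a \<in> f_span}"
    by (rule f_span_subset) (simp add: assms(2))
  with assms(3) show ?thesis by blast
qed

lemma f_span_Z22: "u \<in> f_span \<Longrightarrow> u \<triangleleft>\<^bsub>V\<^esub> Z q G22 \<in> f_span"
  by (erule f_span_stable[rotated 2]) (simp_all add: f_in_span flip: f_Suc_right)

lemma f_span_Z21: "u \<in> f_span \<Longrightarrow> u \<triangleleft>\<^bsub>V\<^esub> Z q G21 \<in> f_span"
proof (erule f_span_stable[rotated 2])
  fix i j assume i: "i < m"
  show "f i j \<triangleleft>\<^bsub>V\<^esub> Z q G21 \<in> f_span"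
  proof (cases "Suc i = m")
    case True
    then show ?thesis
      using f_m[of j] f_span_mem(2)[OF f_in_span[OF m_pos]] by (simp flip: f_Suc_left)
  next
    case False
    then show ?thesis
      using i by (simp add: f_in_span flip: f_Suc_left)
  qed
qed simp

text \<open>\<open>Z\<^sub>1\<^sub>2\<close> moves left past every \<open>Z\<^sub>2\<^sub>2\<close>
  and then every \<open>Z\<^sub>2\<^sub>1\<close>, picking up scalars, until it meets
  \<open>f 0 0\<close> and acts by the character. Letting \<open>i\<close> exceed \<open>m\<close>
  keeps the induction uniform.\<close>

lemma f_ract_Z12: "f i j \<triangleleft>\<^bsub>V\<^esub> Z q G12 \<in> f_span"
proof (induction j)
  case 0
  show ?case
  proof (induction i)
    case 0
    show ?case
      using f_0_0_ract[OF B_alg_gen(3)] f_span_mem(2)[OF f_in_span[OF m_pos]] by simp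
  next
    case (Suc i)
    then show ?case
      by (simp add: f_Suc_left V.ract_generators(4) f_span_Z21 f_span_mem)
  qed
next
  case (Suc j)
  then show ?case
    by (simp add: f_Suc_right V.ract_generators(3) f_span_Z22 f_span_mem)
qed

text \<open>The same movement as for \<open>Z\<^sub>1\<^sub>2\<close>, except that passing
  \<open>Z\<^sub>2\<^sub>2\<close> leaves an extra term in \<open>Z\<^sub>1\<^sub>2\<close> and
  \<open>Z\<^sub>2\<^sub>1\<close>, which \<open>f_ract_Z12\<close> and \<open>f_span_Z21\<close>
  keep in the span.\<close>

lemma f_ract_Z11: "f i j \<triangleleft>\<^bsub>V\<^esub> Z q G11 \<in> f_span"
proof (induction j)
  case 0
  show ?case
  proof (induction i)
    case 0
    show ?case
      using f_0_0_ract[OF B_alg_gen(2)] f_span_mem(2)[OF f_in_span[OF m_pos]] by simp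
  next
    case (Suc i)
    then show ?case
      by (simp add: f_Suc_left V.ract_generators(2) f_span_Z21 f_span_mem)
  qed
next
  case (Suc j)
  then show ?case
    by (simp add: f_Suc_right V.ract_generators(5) f_span_Z21 f_span_Z22 f_span_mem f_ract_Z12)
qed

lemma f_span_ract:
  assumes "a \<in> carrier (Mat2 q)" "u \<in> f_span" shows "u \<triangleleft>\<^bsub>V\<^esub> a \<in> f_span"
  using assms
proof (induction arbitrary: u rule: Mat2_induct)
  case (mult a g)
  have "w \<triangleleft>\<^bsub>V\<^esub> Z q g \<in> f_span" if "w \<in> f_span" for w
    using that f_span_Z21 f_span_Z22 f_span_stable[OF Z_in_carrier f_ract_Z11]
      f_span_stable[OF Z_in_carrier f_ract_Z12] by (cases g) auto
  with mult show ?case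
    by (simp add: V.ract_mult f_span_mem(3))
qed (auto simp: f_span_mem V.ract_add_right)

text \<open>The pure tensor of \<open>x\<close> and \<open>a\<close> is \<open>f 0 0\<close> acted
  on by the scalar \<open>x / v\<close> and then by \<open>a\<close>; here
  \<open>v \<noteq> 0\<close> enters.\<close>

lemma f_0_0_generates:
  assumes N: "right_submodule N scal_ring V" and "f 0 0 \<in> N"
    and ract: "\<And>u a. u \<in> N \<Longrightarrow> a \<in> carrier (Mat2 q) \<Longrightarrow> u \<triangleleft>\<^bsub>V\<^esub> a \<in> N"
  shows "carrier V \<subseteq> N"
proof
  interpret right_submodule N scal_ring V by fact
  fix u assume "u \<in> carrier V"
  then show "u \<in> N"
  proof (induction rule: X.extend_scalars_induct)
    case (pure x a)
      have "f 0 0 \<triangleleft>\<^bsub>V\<^esub> scal q (x / v) = pt x \<one>\<^bsub>Mat2 q\<^esub>"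
      using pt_balanced[OF B_alg_gen(1) chi_simps(1), of v "x / v"] v by (simp add: f_0_0 pt_ract)
    then have "f 0 0 \<triangleleft>\<^bsub>V\<^esub> scal q (x / v) \<triangleleft>\<^bsub>V\<^esub> a = pt x a"
      using pure by (simp add: pt_ract)
    then show ?case
      using ract[OF ract[OF assms(2) scal_in_carrier] pure(2)] by metis
  next
    case (diff u w)
    then show ?case by (simp add: a_minus_def)
  qed
qed

lemma f_span_carrier: "carrier V \<subseteq> f_span"
  using f_span_submodule f_in_span[OF m_pos] f_span_ract by (rule f_0_0_generates)

section \<open>The coordinate map of the Verma module\<close>

definition psi :: "'k verma \<Rightarrow> nat \<times> nat \<Rightarrow> 'k"
  where "psi = (SOME k. (\<forall>x. \<forall>a\<in>carrier (Mat2 q). k (pt x a) = scale_fun x (act a (unit_fun 0 0))) \<and>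
     (\<forall>u\<in>carrier V. \<forall>w\<in>carrier V. k (u \<oplus>\<^bsub>V\<^esub> w) = k u + k w))"

text \<open>Sending \<open>(x, a)\<close> to \<open>x\<close> times the image of the base vector
  under \<open>a\<close> is balanced, since \<open>B_alg q m\<close> acts on the base vector through
  \<open>chi\<close> by \<open>act_B_alg\<close> at \<open>n = p * m\<close>. The universal property
  then yields the map chosen in \<open>psi\<close>.\<close>

lemma psi_pt: "a \<in> carrier (Mat2 q) \<Longrightarrow> psi (pt x a) = scale_fun x (act a (unit_fun 0 0))"
  and psi_add: "u \<in> carrier V \<Longrightarrow> w \<in> carrier V \<Longrightarrow> psi (u \<oplus>\<^bsub>V\<^esub> w) = psi u + psi w"
proof -
  have "\<exists>k. (\<forall>x. \<forall>a\<in>carrier (Mat2 q). k (pt x a) = scale_fun x (act a (unit_fun 0 0))) \<and>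
     (\<forall>u\<in>carrier V. \<forall>w\<in>carrier V. k (u \<oplus>\<^bsub>V\<^esub> w) = k u + k w)"
  proof (rule X.extend_scalars_universal[of "\<lambda>x a. scale_fun x (act a (unit_fun 0 0))"])
    fix x r a assume "r \<in> B_alg q m" "a \<in> carrier (Mat2 q)"
    moreover from this have "r \<in> carrier (Mat2 q)" using B_alg_subset by blast
    moreover have "linear_op (act a)"
      using \<open>a \<in> _\<close> by (rule act_simps)
    ultimately show "scale_fun (x \<triangleleft>\<^bsub>K_lambda q m lam1 lam2\<^esub> r) (act a (unit_fun 0 0)) =
        scale_fun x (act (r \<otimes>\<^bsub>Mat2 q\<^esub> a) (unit_fun 0 0))"
      using n_pos by (simp add: act_simps act_B_alg linear_op_def scale_fun_simps(3))
  next
    fix k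
    assume "\<And>x a. x \<in> carrier (K_lambda q m lam1 lam2) \<Longrightarrow> a \<in> carrier (Mat2 q) \<Longrightarrow>
        k (pt x a) = scale_fun x (act a (unit_fun 0 0))"
      and "\<And>u w. u \<in> carrier V \<Longrightarrow> w \<in> carrier V \<Longrightarrow> k (u \<oplus>\<^bsub>V\<^esub> w) = k u + k w"
    then show ?thesis by (intro exI[of _ k]) simp
  qed (simp_all add: scale_fun_simps act_simps)
  then have *: "(\<forall>x. \<forall>a\<in>carrier (Mat2 q). psi (pt x a) = scale_fun x (act a (unit_fun 0 0))) \<and>
     (\<forall>u\<in>carrier V. \<forall>w\<in>carrier V. psi (u \<oplus>\<^bsub>V\<^esub> w) = psi u + psi w)"
    unfolding psi_def by (rule someI_ex)
  show "a \<in> carrier (Mat2 q) \<Longrightarrow> psi (pt x a) = scale_fun x (act a (unit_fun 0 0))"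
    "u \<in> carrier V \<Longrightarrow> w \<in> carrier V \<Longrightarrow> psi (u \<oplus>\<^bsub>V\<^esub> w) = psi u + psi w"
    using * by blast+
qed

lemma psi_zero: "psi \<zero>\<^bsub>V\<^esub> = 0"
  using psi_add[of "\<zero>\<^bsub>V\<^esub>" "\<zero>\<^bsub>V\<^esub>"] by simp

lemma psi_minus:
  assumes "u \<in> carrier V" "w \<in> carrier V" shows "psi (u \<ominus>\<^bsub>V\<^esub> w) = psi u - psi w"
proof -
  have "psi ((u \<ominus>\<^bsub>V\<^esub> w) \<oplus>\<^bsub>V\<^esub> w) = psi (u \<ominus>\<^bsub>V\<^esub> w) + psi w"
    using assms by (intro psi_add) auto
  moreover have "(u \<ominus>\<^bsub>V\<^esub> w) \<oplus>\<^bsub>V\<^esub> w = u"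
    using assms by (simp add: a_minus_def V.a_assoc V.M.l_neg)
  ultimately show ?thesis by simp
qed

lemma psi_ract:
  assumes "u \<in> carrier V" and a: "a \<in> carrier (Mat2 q)"
  shows "psi (u \<triangleleft>\<^bsub>V\<^esub> a) = act a (psi u)"
  using assms(1)
proof (induction rule: X.extend_scalars_induct)
  case (pure x c)
  then show ?case
    using act_simps(6)[OF a] a ring.ring_simprules(5)[OF ring_Mat2]
    by (simp add: pt_ract psi_pt act_simps linear_op_def)
next
  case (diff u w)
  then have "psi ((u \<ominus>\<^bsub>V\<^esub> w) \<triangleleft>\<^bsub>V\<^esub> a) = act a (psi u) - act a (psi w)"
    using a by (simp add: a_minus_def V.ract_add_left V.ract_minus_left V.ract_closed
        flip: psi_minus)
      (simp add: psi_minus V.ract_closed flip: a_minus_def)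
  moreover have "act a (psi u - psi w) = act a (psi u) - act a (psi w)"
    using act_simps(6)[OF a] unfolding linear_op_def by (metis add_diff_cancel diff_add_cancel)
  ultimately show ?case
    using diff by (simp only: psi_minus)
qed

lemma psi_support:
  assumes "u \<in> carrier V" "a \<ge> m \<or> b \<ge> p * m"
  shows "psi u (a, b) = 0"
proof -
  \<comment> \<open>The functions supported on the rectangle \<open>a < m\<close>,
    \<open>b < p * m\<close>; every operator preserves this support.\<close>
  let ?W = "{g :: nat \<times> nat \<Rightarrow> 'k. \<forall>a b. a \<ge> m \<or> b \<ge> p * m \<longrightarrow> g (a, b) = 0}"
  have op: "verma_op (p * m) x g \<in> ?W" if "g \<in> ?W" for x g
    using that m_pos by (cases x) auto
  have "psi u \<in> ?W"
    using assms(1)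
  proof (induction rule: X.extend_scalars_induct)
    case (pure x c)
    have "act c (unit_fun 0 0) \<in> ?W"
      by (rule mat2_act_closed[OF ops pure(2) _ _ _ op])
        (use m_pos n_pos in \<open>auto simp: unit_fun_def scale_fun_def\<close>)
    then show ?case
      using pure by (simp add: psi_pt scale_fun_def)
  qed (simp add: psi_minus)
  with assms(2) show ?thesis by blast
qed

lemma psi_f:
  assumes "a < m"
  shows "psi (f a b) = (if b < p * m then scale_fun v (unit_fun a b) else 0)"
proof (induction b)
  case 0
  show ?case
    using n_pos act_Z21_pow[of "p * m" a 0] assms by (simp add: f_vec_def psi_pt)
next
  case (Suc b)
  have "linear_op (act (Z q G22))"
    by (rule act_simps(6)) simp
  then have lin: "verma_op (p * m) G22 (scale_fun c g) = scale_fun c (verma_op (p * m) G22 g)" for c g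
    by (simp add: linear_op_def act_simps del: verma_op.simps)
  moreover have "verma_op (p * m) G22 0 = 0"
    using lin[of 0 0] by (simp add: scale_fun_simps del: verma_op.simps)
  ultimately show ?case
    using Suc by (auto simp: f_Suc_right psi_ract act_simps verma_op_unit_fun scale_fun_simps(6)
        simp del: verma_op.simps)
qed

section \<open>The submodule as kernel of the coordinate map\<close>

abbreviation M_p :: "'k verma set"
  where "M_p \<equiv> M_sub q m lam1 lam2 v p"

lemma M_p_eq: "M_p = rspan scal_ring V {f a (p * m + i) | a i. a < m}"
  by (simp add: M_sub_def scal_ring_def)

lemma M_p_scal_submodule: "right_submodule M_p scal_ring V"
  unfolding M_p_eq by (rule S.rspan_submodule) auto

lemmas M_p_mem = scal_submodule_mem[OF M_p_scal_submodule]

lemma psi_M_p: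
  assumes "u \<in> M_p" shows "psi u = 0"
proof -
  have "right_submodule {u \<in> carrier V. psi u = 0} scal_ring V"
    by (rule S.right_submoduleI)
      (auto simp: psi_add psi_zero psi_ract act_simps scale_fun_simps V.ract_closed)
  then have "M_p \<subseteq> {u \<in> carrier V. psi u = 0}"
    unfolding M_p_eq by (rule rspan_subset) (auto simp: psi_f)
  with assms show ?thesis by blast
qed

text \<open>A linear section of \<open>psi\<close> up to the factor \<open>v\<close>.\<close>

definition theta :: "(nat \<times> nat \<Rightarrow> 'k) \<Rightarrow> 'k verma"
  where "theta c = (\<Oplus>\<^bsub>V\<^esub>i\<in>{..<m} \<times> {..<p * m}. f (fst i) (snd i) \<triangleleft>\<^bsub>V\<^esub> scal q (c i))"

lemma term_closed [simp]: "f a b \<triangleleft>\<^bsub>V\<^esub> scal q c \<in> carrier V"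
  by (simp add: V.ract_closed)

lemma theta_closed [simp]: "theta c \<in> carrier V"
  by (auto simp: theta_def)

lemma theta_add: "theta (c + d) = theta c \<oplus>\<^bsub>V\<^esub> theta d"
  unfolding theta_def
  by (subst V.M.finsum_addf[symmetric]) (auto simp: scal_simps V.ract_add_right intro!: V.M.finsum_cong')

lemma theta_scale: "theta (scale_fun k c) = theta c \<triangleleft>\<^bsub>V\<^esub> scal q k"
proof -
  have "(\<Oplus>\<^bsub>V\<^esub>i\<in>A. f (fst i) (snd i) \<triangleleft>\<^bsub>V\<^esub> scal q (scale_fun k c i)) =
      (\<Oplus>\<^bsub>V\<^esub>i\<in>A. f (fst i) (snd i) \<triangleleft>\<^bsub>V\<^esub> scal q (c i)) \<triangleleft>\<^bsub>V\<^esub> scal q k"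
    if "finite A" for A
    using that
  proof (induction A rule: finite_induct)
    case empty
    show ?case by (simp add: V.ract_zero_left)
  next
    case (insert i A)
    have "scal q (k * c i) = scal q (c i) \<otimes>\<^bsub>Mat2 q\<^esub> scal q k"
      by (simp add: mult.commute flip: scal_simps(3))
    moreover have "(\<Oplus>\<^bsub>V\<^esub>i\<in>insert i A. f (fst i) (snd i) \<triangleleft>\<^bsub>V\<^esub> scal q (d i)) =
        f (fst i) (snd i) \<triangleleft>\<^bsub>V\<^esub> scal q (d i) \<oplus>\<^bsub>V\<^esub> (\<Oplus>\<^bsub>V\<^esub>i\<in>A. f (fst i) (snd i) \<triangleleft>\<^bsub>V\<^esub> scal q (d i))"
      for d
      using insert by (intro V.M.finsum_insert) auto
    ultimately show ?case
      using insert(3) by (simp add: V.ract_add_left V.ract_mult scale_fun_apply del: V.M.finsum_insert)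
  qed
  then show ?thesis
    unfolding theta_def by simp
qed

lemma theta_eq_0:
  assumes "\<And>a b. a < m \<Longrightarrow> b < p * m \<Longrightarrow> c (a, b) = 0" shows "theta c = \<zero>\<^bsub>V\<^esub>"
proof -
  have "theta c = (\<Oplus>\<^bsub>V\<^esub>i\<in>{..<m} \<times> {..<p * m}. \<zero>\<^bsub>V\<^esub>)"
    unfolding theta_def
    by (intro V.M.finsum_cong') (auto simp: assms scal_simps V.ract_zero_right)
  then show ?thesis by simp
qed

lemma theta_unit:
  assumes "a < m" "b < p * m" shows "theta (unit_fun a b) = f a b"
proof -
  have "theta (unit_fun a b) =
      (\<Oplus>\<^bsub>V\<^esub>i\<in>{..<m} \<times> {..<p * m}. if (a, b) = i then f (fst i) (snd i) else \<zero>\<^bsub>V\<^esub>)"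
    unfolding theta_def
    by (intro V.M.finsum_cong') (auto simp: unit_fun_def scal_simps V.ract_zero_right V.ract_one)
  also have "\<dots> = f a b"
    using V.M.finsum_singleton[of "(a, b)" "{..<m} \<times> {..<p * m}" "\<lambda>i. f (fst i) (snd i)"] assms
    by simp
  finally show ?thesis .
qed

lemma sum_fun_apply: "(\<Sum>i\<in>A. g i) x = (\<Sum>i\<in>A. g i x)"
  by (induction A rule: infinite_finite_induct) auto

lemma psi_theta:
  assumes "a < m" "b < p * m" shows "psi (theta c) (a, b) = v * c (a, b)"
proof -
  have "psi (\<Oplus>\<^bsub>V\<^esub>i\<in>A. f (fst i) (snd i) \<triangleleft>\<^bsub>V\<^esub> scal q (c i)) =
      (\<Sum>i\<in>A. scale_fun (c i) (psi (f (fst i) (snd i))))" if "finite A" for A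
    using that
  proof (induction A rule: finite_induct)
    case (insert i A)
    then show ?case
      by (simp add: psi_add psi_ract act_simps)
  qed (simp add: psi_zero)
  then have "psi (theta c) = (\<Sum>i\<in>{..<m} \<times> {..<p * m}. scale_fun (c i) (psi (f (fst i) (snd i))))"
    unfolding theta_def by simp
  also have "\<dots> = (\<Sum>i\<in>{..<m} \<times> {..<p * m}. scale_fun (c i) (scale_fun v (unit_fun (fst i) (snd i))))"
    by (rule sum.cong) (auto simp: psi_f)
  finally have "psi (theta c) (a, b) =
      (\<Sum>i\<in>{..<m} \<times> {..<p * m}. c i * (v * unit_fun (fst i) (snd i) (a, b)))"
    by (simp add: sum_fun_apply scale_fun_apply)
  also have "\<dots> = (\<Sum>i\<in>{..<m} \<times> {..<p * m}. if (a, b) = i then c i * v else 0)"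
    by (rule sum.cong) (auto simp: unit_fun_def)
  also have "\<dots> = v * c (a, b)"
    using assms by (subst sum.delta') (simp_all add: mult.commute)
  finally show ?thesis .
qed

text \<open>Each \<open>f a b\<close> with \<open>a < m\<close> is a value of \<open>theta\<close>
  or lies in \<open>M_p\<close>, so every vector is \<open>theta c \<oplus> s\<close> with
  \<open>s \<in> M_p\<close>. There \<open>psi\<close> returns \<open>v * c\<close> on the
  rectangle, so vanishing of \<open>psi\<close> forces \<open>theta c\<close> to be zero.\<close>

lemma psi_kernel:
  assumes "u \<in> carrier V" "psi u = 0" shows "u \<in> M_p"
proof -
  let ?T = "{theta c \<oplus>\<^bsub>V\<^esub> s | c s. s \<in> M_p}"
  have "right_submodule ?T scal_ring V"
  proof (rule S.right_submoduleI)
    show "?T \<subseteq> carrier V"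
      using M_p_mem(3) by auto
    have "\<zero>\<^bsub>V\<^esub> = theta 0 \<oplus>\<^bsub>V\<^esub> \<zero>\<^bsub>V\<^esub>"
      using theta_eq_0[of 0] by simp
    then show "\<zero>\<^bsub>V\<^esub> \<in> ?T"
      using M_p_mem(4) by blast
    show "x \<oplus>\<^bsub>V\<^esub> y \<in> ?T" if xy: "x \<in> ?T" "y \<in> ?T" for x y
    proof -
      obtain c s d t where st: "s \<in> M_p" "t \<in> M_p"
        and eq: "x = theta c \<oplus>\<^bsub>V\<^esub> s" "y = theta d \<oplus>\<^bsub>V\<^esub> t" using xy by blast
      have "x \<oplus>\<^bsub>V\<^esub> y = theta (c + d) \<oplus>\<^bsub>V\<^esub> (s \<oplus>\<^bsub>V\<^esub> t)"
        unfolding eq theta_add using st M_p_mem(3) by (simp add: V.M.a_ac)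
      then show ?thesis using M_p_mem(1)[OF st] by blast
    qed
    show "x \<triangleleft>\<^bsub>V\<^esub> a \<in> ?T" if xa: "x \<in> ?T" "a \<in> carrier scal_ring" for x a
    proof -
      obtain c s k where s: "s \<in> M_p" and eq: "x = theta c \<oplus>\<^bsub>V\<^esub> s" "a = scal q k"
        using xa by auto
      have "x \<triangleleft>\<^bsub>V\<^esub> a = theta (scale_fun k c) \<oplus>\<^bsub>V\<^esub> s \<triangleleft>\<^bsub>V\<^esub> scal q k"
        unfolding eq theta_scale using s M_p_mem(3) by (simp add: V.ract_add_left)
      then show ?thesis using M_p_mem(2)[OF s] by blast
    qed
  qed
  moreover have "f a b \<in> ?T" if "a < m" for a b
  proof (cases "b < p * m")
    case True
    then have "f a b = theta (unit_fun a b) \<oplus>\<^bsub>V\<^esub> \<zero>\<^bsub>V\<^esub>"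
      using that theta_unit by simp
    then show ?thesis using M_p_mem(4) by blast
  next
    case False
    then have "f a b = f a (p * m + (b - p * m))" by simp
    then have "f a b \<in> M_p"
      unfolding M_p_eq using that by (intro subsetD[OF subset_rspan]) blast
    moreover have "f a b = theta 0 \<oplus>\<^bsub>V\<^esub> f a b"
      using theta_eq_0[of 0] by simp
    ultimately show ?thesis by blast
  qed
  ultimately have "f_span \<subseteq> ?T"
    by (intro f_span_subset)
  then obtain c s where s: "s \<in> M_p" and u: "u = theta c \<oplus>\<^bsub>V\<^esub> s"
    using f_span_carrier assms(1) by blast
  then have "psi (theta c) = 0"
    using assms(2) psi_add[of "theta c" s] psi_M_p[OF s] M_p_mem(3)[OF s] by simp
  then have "c (a, b) = 0" if "a < m" "b < p * m" for a b
    using psi_theta[OF that, of c] v by simp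
  then have "theta c = \<zero>\<^bsub>V\<^esub>"
    by (rule theta_eq_0)
  with s u show ?thesis using M_p_mem(3) by simp
qed

text \<open>By construction \<open>M_p\<close> is only a linear span; being the kernel of
  \<open>psi\<close>, which intertwines the actions, it is stable under the whole algebra.\<close>

lemma M_p_submodule: "right_submodule M_p (Mat2 q) V"
proof (rule V.right_submoduleI)
  fix u a assume u: "u \<in> M_p" and a: "a \<in> carrier (Mat2 q)"
  have "act a (scale_fun 0 0) = scale_fun 0 (act a 0)"
    using act_simps(6)[OF a] unfolding linear_op_def by blast
  then have "act a 0 = 0"
    by (simp add: scale_fun_simps)
  then show "u \<triangleleft>\<^bsub>V\<^esub> a \<in> M_p"
    using u a psi_M_p[OF u] M_p_mem(3)[OF u]
    by (intro psi_kernel) (simp_all add: psi_ract V.ract_closed)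
qed (use M_p_mem in auto)

sublocale Q: ract_quotient M_p "Mat2 q" V
  by (rule V.ract_quotient[OF M_p_submodule])

section \<open>Coordinates on the quotient module\<close>

abbreviation Q :: "((gen, 'k) free_algebra set, 'k verma set) rmodule"
  where "Q \<equiv> Q_mod q m lam1 lam2 v p"

lemma Q_eq: "Q = rquot V M_p"
  by (simp add: Q_mod_def)

sublocale QM: mat2_module q Q
  unfolding Q_eq by (intro mat2_module.intro Q.right_module_rquot)

definition phi :: "'k verma set \<Rightarrow> nat \<times> nat \<Rightarrow> 'k"
  where "phi = (SOME k. \<forall>u\<in>carrier V. k (M_p +>\<^bsub>V\<^esub> u) = psi u)"

lemma phi_coset: "u \<in> carrier V \<Longrightarrow> phi (M_p +>\<^bsub>V\<^esub> u) = psi u"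
proof -
  have "\<exists>k. \<forall>u\<in>carrier V. k (M_p +>\<^bsub>V\<^esub> u) = psi u"
  proof (rule Q.factor_rquot[of psi])
    fix k assume "\<And>u. u \<in> carrier V \<Longrightarrow> k (M_p +>\<^bsub>V\<^esub> u) = psi u"
    then show ?thesis by (intro exI[of _ k]) simp
  qed (simp_all add: psi_add psi_M_p)
  then have "\<forall>u\<in>carrier V. phi (M_p +>\<^bsub>V\<^esub> u) = psi u"
    unfolding phi_def by (rule someI_ex)
  then show "u \<in> carrier V \<Longrightarrow> phi (M_p +>\<^bsub>V\<^esub> u) = psi u" by blast
qed

lemma Q_cases:
  assumes "x \<in> carrier Q" obtains u where "u \<in> carrier V" "x = M_p +>\<^bsub>V\<^esub> u"
  using assms unfolding Q_eq Q.carrier_rquot by blast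

lemma phi_add: "x \<in> carrier Q \<Longrightarrow> y \<in> carrier Q \<Longrightarrow> phi (x \<oplus>\<^bsub>Q\<^esub> y) = phi x + phi y"
  by (elim Q_cases) (simp add: Q_eq Q.add_rquot phi_coset psi_add)

lemma phi_ract: "x \<in> carrier Q \<Longrightarrow> a \<in> carrier (Mat2 q) \<Longrightarrow> phi (x \<triangleleft>\<^bsub>Q\<^esub> a) = act a (phi x)"
  by (elim Q_cases) (simp add: Q_eq Q.ract_rquot phi_coset psi_ract V.ract_closed)

lemma phi_inj:
  assumes "x \<in> carrier Q" "y \<in> carrier Q" "phi x = phi y" shows "x = y"
proof -
  obtain u w where uw: "u \<in> carrier V" "x = M_p +>\<^bsub>V\<^esub> u" "w \<in> carrier V" "y = M_p +>\<^bsub>V\<^esub> w"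
    using assms(1,2) by (elim Q_cases)
  then have "u \<ominus>\<^bsub>V\<^esub> w \<in> M_p"
    using assms(3) by (intro psi_kernel) (simp_all add: phi_coset psi_minus)
  with uw show ?thesis by (simp add: Q.coset_eq_iff)
qed

lemma phi_zero: "phi \<zero>\<^bsub>Q\<^esub> = 0"
  using phi_coset[OF V.M.zero_closed] by (simp add: Q_eq Q.zero_rquot psi_zero)

lemma phi_support: "x \<in> carrier Q \<Longrightarrow> a \<ge> m \<or> b \<ge> p * m \<Longrightarrow> phi x (a, b) = 0"
  by (elim Q_cases) (simp add: phi_coset psi_support)

definition cyc :: "'k verma set"
  where "cyc = M_p +>\<^bsub>V\<^esub> f 0 0"

lemma cyc_closed [simp]: "cyc \<in> carrier Q"
  unfolding cyc_def Q_eq Q.carrier_rquot by simp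

lemma phi_cyc: "phi cyc = scale_fun v (unit_fun 0 0)"
  using m_pos n_pos by (simp add: cyc_def phi_coset psi_f)

text \<open>The preimage of \<open>K\<close> in \<open>V\<close> is stable under the algebra and
  contains \<open>f 0 0\<close>, which generates \<open>V\<close>.\<close>

lemma cyc_generates:
  assumes "right_submodule K (Mat2 q) Q" "cyc \<in> K" shows "K = carrier Q"
proof -
  interpret K: right_submodule K "Mat2 q" Q by fact
  let ?N = "{u \<in> carrier V. M_p +>\<^bsub>V\<^esub> u \<in> K}"
  have ract: "u \<triangleleft>\<^bsub>V\<^esub> a \<in> ?N" if "u \<in> ?N" "a \<in> carrier (Mat2 q)" for u a
    using that K.ract_closed[of "M_p +>\<^bsub>V\<^esub> u" a] by (simp add: Q_eq Q.ract_rquot V.ract_closed)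
  have "right_submodule ?N scal_ring V"
  proof (rule S.right_submoduleI)
    show "\<zero>\<^bsub>V\<^esub> \<in> ?N"
      using K.zero_closed by (simp add: Q_eq Q.zero_rquot)
    show "x \<oplus>\<^bsub>V\<^esub> y \<in> ?N" if "x \<in> ?N" "y \<in> ?N" for x y
      using that K.a_closed[of "M_p +>\<^bsub>V\<^esub> x" "M_p +>\<^bsub>V\<^esub> y"] by (simp add: Q_eq Q.add_rquot)
  qed (use ract in auto)
  then have "carrier V \<subseteq> ?N"
    by (rule f_0_0_generates) (use assms(2) ract in \<open>auto simp: cyc_def\<close>)
  then have "carrier Q \<subseteq> K"
    unfolding Q_eq Q.carrier_rquot by blast
  then show ?thesis using K.a_subset by blast
qed

lemma cyc_nz: "cyc \<noteq> \<zero>\<^bsub>Q\<^esub>"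
proof
  assume "cyc = \<zero>\<^bsub>Q\<^esub>"
  then have "scale_fun v (unit_fun 0 0) = 0"
    using phi_cyc phi_zero by simp
  then have "scale_fun v (unit_fun 0 0) (0, 0) = 0" by simp
  then show False using v by (simp add: scale_fun_def unit_fun_def)
qed

section \<open>The socle, indecomposability and simplicity\<close>

lemma socle_unit:
  assumes "right_submodule K (Mat2 q) Q" "K \<noteq> {\<zero>\<^bsub>Q\<^esub>}"
  shows "\<exists>x\<in>K. phi x = unit_fun 0 (p * m - m)"
proof -
  interpret K: right_submodule K "Mat2 q" Q by fact
  have sub: "x \<in> carrier Q" if "x \<in> K" for x
    using that K.a_subset by blast
  obtain x where x: "x \<in> K" "x \<noteq> \<zero>\<^bsub>Q\<^esub>"
    using assms(2) K.zero_closed by blast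
  \<comment> \<open>The image of \<open>K\<close> under \<open>phi\<close> is a subspace stable
    under the operators because \<open>phi\<close> intertwines the actions, and it is nonzero
    because \<open>phi\<close> is injective.\<close>
  have "unit_fun 0 (p * m - m) \<in> phi ` K"
  proof (rule top_unit_fun_mem[of "p * m" p _ "phi x"])
    show "g + h \<in> phi ` K" if gh: "g \<in> phi ` K" "h \<in> phi ` K" for g h
    proof -
      obtain x y where xy: "x \<in> K" "g = phi x" "y \<in> K" "h = phi y" using gh by blast
      then have "g + h = phi (x \<oplus>\<^bsub>Q\<^esub> y)"
        by (simp add: phi_add sub)
      then show ?thesis using K.a_closed[OF xy(1,3)] by blast
    qed
    show "scale_fun c g \<in> phi ` K" if gK: "g \<in> phi ` K" for c g
    proof -
      obtain y where y: "y \<in> K" "g = phi y" using gK by blast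
      then have "scale_fun c g = phi (y \<triangleleft>\<^bsub>Q\<^esub> scal q c)"
        by (simp add: phi_ract sub act_simps)
      then show ?thesis using K.ract_closed[OF y(1) scal_in_carrier] by blast
    qed
    show "verma_op (p * m) s g \<in> phi ` K" if gK: "g \<in> phi ` K" for s g
    proof -
      obtain y where y: "y \<in> K" "g = phi y" using gK by blast
      then have "verma_op (p * m) s g = phi (y \<triangleleft>\<^bsub>Q\<^esub> Z q s)"
        by (simp add: phi_ract sub act_simps del: verma_op.simps)
      then show ?thesis using K.ract_closed[OF y(1) Z_in_carrier] by blast
    qed
    show "phi x \<noteq> 0"
      using x phi_inj[OF sub[OF x(1)] QM.M.zero_closed] by (auto simp: phi_zero)
    show "phi x (a, b) = 0" if "m \<le> a \<or> p * m \<le> b" for a b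
      using phi_support[OF sub[OF x(1)] that] .
  qed (use p x in auto)
  then show ?thesis by auto
qed

lemma Q_nontrivial: "carrier Q \<noteq> {\<zero>\<^bsub>Q\<^esub>}"
  using cyc_closed cyc_nz by blast

text \<open>Every nonzero submodule contains an element with the same prescribed coordinates, and
  injectivity of \<open>phi\<close> makes it one and the same element. The whole module supplies its
  existence.\<close>

lemma monolithic:
  "\<exists>t\<in>carrier Q. t \<noteq> \<zero>\<^bsub>Q\<^esub> \<and> phi t = unit_fun 0 (p * m - m) \<and>
    (\<forall>K. right_submodule K (Mat2 q) Q \<longrightarrow> K \<noteq> {\<zero>\<^bsub>Q\<^esub>} \<longrightarrow> t \<in> K)"
proof -
  obtain t where t: "t \<in> carrier Q" "phi t = unit_fun 0 (p * m - m)"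
    using socle_unit[OF QM.carrier_submodule Q_nontrivial] by blast
  have "unit_fun 0 (p * m - m) (0, p * m - m) \<noteq> 0"
    by (simp add: unit_fun_def)
  then have "t \<noteq> \<zero>\<^bsub>Q\<^esub>"
    using t(2) phi_zero by auto
  moreover have "t \<in> K" if K: "right_submodule K (Mat2 q) Q" "K \<noteq> {\<zero>\<^bsub>Q\<^esub>}" for K
  proof -
    interpret K: right_submodule K "Mat2 q" Q by (rule K)
    obtain x where "x \<in> K" "phi x = unit_fun 0 (p * m - m)"
      using socle_unit[OF K] by blast
    moreover from this have "x = t"
      using t K.a_subset by (intro phi_inj) auto
    ultimately show ?thesis by simp
  qed
  ultimately show ?thesis using t by blast
qed

lemma indecomposable: "indecomposable_rmodule (Mat2 q) Q"
proof -
  obtain t where "t \<noteq> \<zero>\<^bsub>Q\<^esub>"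
    "\<forall>K. right_submodule K (Mat2 q) Q \<longrightarrow> K \<noteq> {\<zero>\<^bsub>Q\<^esub>} \<longrightarrow> t \<in> K"
    using monolithic by blast
  then show ?thesis
    by (intro QM.indecomposable_of_monolithic[of t] Q_nontrivial) simp_all
qed

lemma simple_of_semisimple:
  assumes "semisimple_rmodule (Mat2 q) Q" shows "simple_rmodule (Mat2 q) Q"
proof -
  obtain t where "t \<noteq> \<zero>\<^bsub>Q\<^esub>"
    "\<forall>K. right_submodule K (Mat2 q) Q \<longrightarrow> K \<noteq> {\<zero>\<^bsub>Q\<^esub>} \<longrightarrow> t \<in> K"
    using monolithic by blast
  then show ?thesis
    by (intro QM.simple_of_monolithic_semisimple[of t] Q_nontrivial assms) simp_all
qed

lemma simple:
  assumes "p = 1" shows "simple_rmodule (Mat2 q) Q"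
proof -
  obtain t where t: "t \<in> carrier Q" "phi t = unit_fun 0 (p * m - m)"
    and mono: "\<forall>K. right_submodule K (Mat2 q) Q \<longrightarrow> K \<noteq> {\<zero>\<^bsub>Q\<^esub>} \<longrightarrow> t \<in> K"
    using monolithic by blast
  have "p * m - m = 0"
    using assms by simp
  \<comment> \<open>For \<open>p = 1\<close> the common element has coordinates
    \<open>unit_fun 0 0\<close>, so the cyclic generator is its multiple by
    \<open>v\<close>.\<close>
  then have cyc: "cyc = t \<triangleleft>\<^bsub>Q\<^esub> scal q v"
    using t by (intro phi_inj) (simp_all add: phi_cyc phi_ract act_simps QM.ract_closed)
  have "K = carrier Q" if K: "right_submodule K (Mat2 q) Q" "K \<noteq> {\<zero>\<^bsub>Q\<^esub>}" for K
  proof -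
    interpret K: right_submodule K "Mat2 q" Q by (rule K)
    show ?thesis
      using cyc_generates[OF K(1)] mono K K.ract_closed[OF _ scal_in_carrier] cyc by simp
  qed
  then show ?thesis
    using QM.right_module_axioms Q_nontrivial by (auto simp: simple_rmodule_def)
qed

lemma not_simple:
  assumes "p > 1" shows "\<not> simple_rmodule (Mat2 q) Q"
proof
  assume simple: "simple_rmodule (Mat2 q) Q"
  \<comment> \<open>The functions vanishing on all rows below \<open>m\<close>. Only
    \<open>Z\<^sub>1\<^sub>1\<close> lowers rows, and its factor from row \<open>m\<close> to row
    \<open>m - 1\<close> is \<open>q ^ m - 1 = 0\<close>, so this space is stable.\<close>
  let ?W = "{g :: nat \<times> nat \<Rightarrow> 'k. \<forall>a b. b < m \<longrightarrow> g (a, b) = 0}"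
  have edge: "q * q ^ b = 1" if "Suc b = m" for b
    using q_pow_m that by auto
  have op: "verma_op (p * m) x g \<in> ?W" if "g \<in> ?W" for x g
  proof (cases x)
    case G11
    have "b < m \<Longrightarrow> (q ^ (b + 1) - 1) * g (a, b + 1) = 0" for a b
      using that edge[of b] by (cases "Suc b = m") auto
    then show ?thesis using G11 by (simp add: mult.assoc del: mult_eq_0_iff)
  qed (use that in auto)
  let ?K = "{x \<in> carrier Q. phi x \<in> ?W}"
  have "right_submodule ?K (Mat2 q) Q"
  proof (rule QM.right_submoduleI)
    show "x \<triangleleft>\<^bsub>Q\<^esub> a \<in> ?K" if xK: "x \<in> ?K" and a: "a \<in> carrier (Mat2 q)" for x a
    proof -
      have "act a (phi x) \<in> ?W"
        by (rule mat2_act_closed[OF ops a _ _ _ op]) (use xK in \<open>auto simp: scale_fun_def\<close>)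
      then show ?thesis using xK a by (simp add: phi_ract QM.ract_closed)
    qed
  qed (auto simp: phi_zero phi_add)
  moreover have "cyc \<notin> ?K"
    using m_pos v by (auto simp: phi_cyc scale_fun_def unit_fun_def)
  then have "?K \<noteq> carrier Q"
    using cyc_closed by blast
  moreover obtain t where t: "t \<in> carrier Q" "t \<noteq> \<zero>\<^bsub>Q\<^esub>" "phi t = unit_fun 0 (p * m - m)"
    using monolithic by blast
  \<comment> \<open>The common element sits in row \<open>(p - 1) * m\<close>, which is at least
    \<open>m\<close> because \<open>p > 1\<close>; it shows that \<open>?K\<close> is
    nonzero.\<close>
  have "2 * m \<le> p * m"
    using assms by (intro mult_le_mono1) simp
  then have "m \<le> p * m - m" by linarith
  then have "t \<in> ?K"
    using t by (auto simp: unit_fun_def)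
  then have "?K \<noteq> {\<zero>\<^bsub>Q\<^esub>}"
    using t by blast
  ultimately show False
    using simple unfolding simple_rmodule_def by blast
qed

end

theorem theorem4p1:
  fixes q lam1 lam2 v :: "'k::alg_closed_field" and m :: nat
  assumes "q \<noteq> 0" and "primitive_root_of_unity m q"
    and "lam1 \<noteq> 0" and "lam2 \<noteq> 0" and "v \<noteq> 0"
  shows "simple_rmodule (Mat2 q) (Q_mod q m lam1 lam2 v 1) \<and>
    (\<forall>p>1. \<not> simple_rmodule (Mat2 q) (Q_mod q m lam1 lam2 v p) \<and>
           \<not> semisimple_rmodule (Mat2 q) (Q_mod q m lam1 lam2 v p)) \<and>
    (\<forall>p>1. indecomposable_rmodule (Mat2 q) (Q_mod q m lam1 lam2 v p))"
proof -
  have quotient: "verma_quotient q lam1 lam2 m v p" if "p > 0" for p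
    by unfold_locales (use assms that in auto)
  show ?thesis
  proof (intro conjI allI impI)
    show "simple_rmodule (Mat2 q) (Q_mod q m lam1 lam2 v 1)"
      by (rule verma_quotient.simple[OF quotient]) simp_all
  next
    fix p :: nat assume p: "p > 1"
    then have q: "verma_quotient q lam1 lam2 m v p"
      by (intro quotient) simp
    show "\<not> simple_rmodule (Mat2 q) (Q_mod q m lam1 lam2 v p)"
      by (rule verma_quotient.not_simple[OF q p])
    then show "\<not> semisimple_rmodule (Mat2 q) (Q_mod q m lam1 lam2 v p)"
      using verma_quotient.simple_of_semisimple[OF q] by blast
  next
    fix p :: nat assume "p > 1"
    then show "indecomposable_rmodule (Mat2 q) (Q_mod q m lam1 lam2 v p)"
      by (intro verma_quotient.indecomposable quotient) simp
  qed
qed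

end
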